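(* Let $E\in\mathbb{C}^{n\times n}$ be Hermitian, $F\in\mathbb{C}^{m\times n}$, $G\in\mathbb{C}^{m\times m}$, $q\in\mathbb{C}^n$, $r\in\mathbb{C}^m$, with $\begin{bmatrix}E&F^*\\ F&G\end{bmatrix}$ nonsingular, let $\alpha_1,\alpha_2,\alpha_3,\beta_1,\beta_2>0$, and let $\widehat{x}=[\widehat u^{T},\widehat p^{T}]^{T}$ with $\widehat u\in\mathbb{C}^n$, $\widehat p\in\mathbb{C}^m$ be a computed (approximate) solution of $\begin{bmatrix}E&F^*\\ F&G\end{bmatrix}\begin{bmatrix}u\\ p\end{bmatrix}=\begin{bmatrix}q\\ r\end{bmatrix}$. Put $Q=q-E\widehat u-F^*\widehat p$, $R=r-F\widehat u-G\widehat p$, $\mathcal{I}_1=[-\beta_1^{-1}I_{2n}\;\;0_{2n\times 2m}]$, $\mathcal{I}_2=[0_{2m\times 2n}\;\;-\beta_2^{-1}I_{2m}]$, $\mathbf{Y}_1=[\widehat{\mathbf{Y}}_1\;\;0_{2n\times 2m^2}]$, $\mathbf{Y}_2=[0_{2m\times n^2}\;\;\widehat{\mathbf{Y}}_2]$, where $$\widehat{\mathbf{Y}}_1=\begin{bmatrix}\alpha_1^{-1}(\Re(\widehat u)^T\otimes I_n)\mathcal{J}^n_S\mathfrak{D}_{S,n}^{-1}&-\alpha_1^{-1}(\Im(\widehat u)^T\otimes I_n)\mathcal{J}^n_{SK}\mathfrak{D}_{SK,n}^{-1}&\alpha_2^{-1}(I_n\otimes\Re(\widehat p)^T)&\alpha_2^{-1}(I_n\otimes\Im(\widehat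 p)^T)\\ \alpha_1^{-1}(\Im(\widehat u)^T\otimes I_n)\mathcal{J}^n_S\mathfrak{D}_{S,n}^{-1}&\alpha_1^{-1}(\Re(\widehat u)^T\otimes I_n)\mathcal{J}^n_{SK}\mathfrak{D}_{SK,n}^{-1}&\alpha_2^{-1}(I_n\otimes\Im(\widehat p)^T)&-\alpha_2^{-1}(I_n\otimes\Re(\widehat p)^T)\end{bmatrix},$$ $$\widehat{\mathbf{Y}}_2=\begin{bmatrix}\alpha_2^{-1}(\Re(\widehat u)^T\otimes I_m)&-\alpha_2^{-1}(\Im(\widehat u)^T\otimes I_m)&\alpha_3^{-1}(\Re(\widehat p)^T\otimes I_m)&-\alpha_3^{-1}(\Im(\widehat p)^T\otimes I_m)\\ \alpha_2^{-1}(\Im(\widehat u)^T\otimes I_m)&\alpha_2^{-1}(\Re(\widehat u)^T\otimes I_m)&\alpha_3^{-1}(\Im(\widehat p)^T\otimes I_m)&\alpha_3^{-1}(\Re(\widehat p)^T\otimes I_m)\end{bmatrix}.$$ Then the structured backward error without preserving sparsity is $$\xi^{\mathcal{G}_1}(\widehat u,\widehat p)=\left\|\begin{bmatrix}\mathbf{Y}_1&\mathcal{I}_1\\ \mathbf{Y}_2&\mathcal{I}_2\end{bmatrix}^T\left(\begin{bmatrix}\mathbf{Y}_1&\mathcal{I}_1\\ \mathbf{Y}_2&\mathcal{I}_2\end{bmatrix}\begin{bmatrix}\mathbf{Y}_1&\mathcal{I}_1\\ \mathbf{Y}_2&\mathcal{I}_2\end{bmatrix}^T\right)^{-1}\begin{bmatrix}\Re(Q)\\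 \Im(Q)\\ \Re(R)\\ \Im(R)\end{bmatrix}\right\|_2 .$$
   Context: Notation. $\Re,\Im$ are entrywise real and imaginary parts, $T$ is transpose, $*$ is conjugate transpose, $\otimes$ is the Kronecker product, and $\mathrm{vec}$ stacks columns. For a real symmetric $k\times k$ matrix $Z$, $\mathrm{vec}_S(Z)\in\mathbb{R}^{k(k+1)/2}$ stacks the columns of the lower triangle including the diagonal: $(z_{11},\dots,z_{k1},z_{22},\dots,z_{k2},\dots,z_{kk})^T$. For a real skew-symmetric $Z$, $\mathrm{vec}_{SK}(Z)\in\mathbb{R}^{k(k-1)/2}$ stacks the columns of the strict lower triangle: $(z_{21},\dots,z_{k1},z_{32},\dots,z_{k2},\dots,z_{k(k-1)})^T$. $\mathcal{J}^k_S\in\mathbb{R}^{k^2\times k(k+1)/2}$ and $\mathcal{J}^k_{SK}\in\mathbb{R}^{k^2\times k(k-1)/2}$ are the matrices with $\mathrm{vec}(Z)=\mathcal{J}^k_S\mathrm{vec}_S(Z)$ for all real symmetric $Z$ and $\mathrm{vec}(Z)=\mathcal{J}^k_{SK}\mathrm{vec}_{SK}(Z)$ for all real skew-symmetric $Z$. $\mathfrak{D}_{S,k}$ is the diagonal matrix of size $k(k+1)/2$ with entry $1$ at the positions that $\mathrm{vec}_S$ assigns to diagonal entries, i.e. $j=\frac{(2k-(i-2))(i-1)}{2}+1$, $i=1,\dots,k$, and $\sqrt2$ at all other positions; $\mathfrak{D}_{SK,k}=\sqrt2\,I_{k(k-1)/2}$. Structured backward error. $\mathcal{G}_1$ is the set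 of tuples $(\Delta E,\Delta F,\Delta G,\Delta q,\Delta r)$ with $\Delta E\in\mathbb{C}^{n\times n}$ Hermitian, $\Delta F\in\mathbb{C}^{m\times n}$, $\Delta G\in\mathbb{C}^{m\times m}$, $\Delta q\in\mathbb{C}^n$, $\Delta r\in\mathbb{C}^m$ such that $$\begin{bmatrix}E+\Delta E&(F+\Delta F)^*\\ F+\Delta F&G+\Delta G\end{bmatrix}\begin{bmatrix}\widehat u\\ \widehat p\end{bmatrix}=\begin{bmatrix}q+\Delta q\\ r+\Delta r\end{bmatrix}.$$ The structured backward error $\xi^{\mathcal{G}_1}(\widehat u,\widehat p)$ is the minimum over $(\Delta E,\Delta F,\Delta G,\Delta q,\Delta r)\in\mathcal{G}_1$ of $\sqrt{\alpha_1^2\|\Delta E\|_F^2+\alpha_2^2\|\Delta F\|_F^2+\alpha_3^2\|\Delta G\|_F^2+\beta_1^2\|\Delta q\|_2^2+\beta_2^2\|\Delta r\|_2^2}$ ($\|\cdot\|_F$ the Frobenius norm). *)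

theory Defs
  imports "Jordan_Normal_Form.Schur_Decomposition" "Jordan_Normal_Form.Gauss_Jordan_Elimination"
begin

section \<open>Matrix operations\<close>

definition append_cols :: "'a::zero mat \<Rightarrow> 'a mat \<Rightarrow> 'a mat" (infixr \<open>@\<^sub>c\<close> 65) where
  "A @\<^sub>c B = four_block_mat A B (0\<^sub>m 0 (dim_col A)) (0\<^sub>m 0 (dim_col B))"

definition kron :: "'a::times mat \<Rightarrow> 'a mat \<Rightarrow> 'a mat" (infixl \<open>\<Otimes>\<close> 75) where
  "A \<Otimes> B = mat (dim_row A * dim_row B) (dim_col A * dim_col B)
     (\<lambda>(i, j). A $$ (i div dim_row B, j div dim_col B) * B $$ (i mod dim_row B, j mod dim_col B))"

text \<open>Only meaningful for invertible matrices: otherwise \<open>mat_inverse\<close> returns \<open>None\<close>.\<close>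

definition inv_mat :: "'a::field mat \<Rightarrow> 'a mat" where
  "inv_mat A = the (mat_inverse A)"

definition vnorm2 :: "'a::real_normed_vector vec \<Rightarrow> real" where
  "vnorm2 v = sqrt (\<Sum>i<dim_vec v. (norm (v $ i))\<^sup>2)"

definition fnorm :: "'a::real_normed_vector mat \<Rightarrow> real" where
  "fnorm A = sqrt (\<Sum>i<dim_row A. \<Sum>j<dim_col A. (norm (A $$ (i, j)))\<^sup>2)"

definition hermitian_mat :: "complex mat \<Rightarrow> bool" where
  "hermitian_mat A \<longleftrightarrow> square_mat A \<and> mat_adjoint A = A"

abbreviation Re_vec :: "complex vec \<Rightarrow> real vec" where
  "Re_vec \<equiv> map_vec Re"

abbreviation Im_vec :: "complex vec \<Rightarrow> real vec" where
  "Im_vec \<equiv> map_vec Im"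

section \<open>Vectorisation of structured matrices\<close>

definition vec_cols :: "'a mat \<Rightarrow> 'a vec" where
  "vec_cols Z = vec_of_list
     (concat (map (\<lambda>j. map (\<lambda>i. Z $$ (i, j)) [0..<dim_row Z]) [0..<dim_col Z]))"

definition vec_S :: "'a mat \<Rightarrow> 'a vec" where
  "vec_S Z = vec_of_list
     (concat (map (\<lambda>j. map (\<lambda>i. Z $$ (i, j)) [j..<dim_row Z]) [0..<dim_col Z]))"

definition vec_SK :: "'a mat \<Rightarrow> 'a vec" where
  "vec_SK Z = vec_of_list
     (concat (map (\<lambda>j. map (\<lambda>i. Z $$ (i, j)) [Suc j..<dim_row Z]) [0..<dim_col Z]))"

definition J_S :: "nat \<Rightarrow> real mat" where
  "J_S k = (THE J. J \<in> carrier_mat (k\<^sup>2) (k * (k + 1) div 2) \<and>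
     (\<forall>Z \<in> carrier_mat k k. transpose_mat Z = Z \<longrightarrow> vec_cols Z = J *\<^sub>v vec_S Z))"

definition J_SK :: "nat \<Rightarrow> real mat" where
  "J_SK k = (THE J. J \<in> carrier_mat (k\<^sup>2) (k * (k - 1) div 2) \<and>
     (\<forall>Z \<in> carrier_mat k k. transpose_mat Z = - Z \<longrightarrow> vec_cols Z = J *\<^sub>v vec_SK Z))"

text \<open>The position formula is 1-based: the index \<open>j\<close> below corresponds to position \<open>j + 1\<close>.
  No subtraction truncates, since \<open>1 \<le> i \<le> k\<close>.\<close>

definition D_S :: "nat \<Rightarrow> real mat" where
  "D_S k = mat_diag (k * (k + 1) div 2)
     (\<lambda>j. if \<exists>i\<in>{1..k}. j + 1 = (2 * k + 2 - i) * (i - 1) div 2 + 1 then 1 else sqrt 2)"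

definition D_SK :: "nat \<Rightarrow> real mat" where
  "D_SK k = sqrt 2 \<cdot>\<^sub>m 1\<^sub>m (k * (k - 1) div 2)"

section \<open>Structured backward error\<close>

definition saddle_mat :: "complex mat \<Rightarrow> complex mat \<Rightarrow> complex mat \<Rightarrow> complex mat" where
  "saddle_mat E F G = four_block_mat E (mat_adjoint F) F G"

type_synonym perturbation =
  "complex mat \<times> complex mat \<times> complex mat \<times> complex vec \<times> complex vec"

text \<open>The dimensions are those of the approximate solution: \<open>n = dim_vec u\<close>, \<open>m = dim_vec p\<close>.\<close>

definition perturbations_G1 ::
  "complex mat \<Rightarrow> complex mat \<Rightarrow> complex mat \<Rightarrow> complex vec \<Rightarrow> complex vec \<Rightarrow>
   complex vec \<Rightarrow> complex vec \<Rightarrow> perturbation set" where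
  "perturbations_G1 E F G q r u p =
     {(\<Delta>E, \<Delta>F, \<Delta>G, \<Delta>q, \<Delta>r).
        \<Delta>E \<in> carrier_mat (dim_vec u) (dim_vec u) \<and> hermitian_mat \<Delta>E \<and>
        \<Delta>F \<in> carrier_mat (dim_vec p) (dim_vec u) \<and>
        \<Delta>G \<in> carrier_mat (dim_vec p) (dim_vec p) \<and>
        \<Delta>q \<in> carrier_vec (dim_vec u) \<and> \<Delta>r \<in> carrier_vec (dim_vec p) \<and>
        saddle_mat (E + \<Delta>E) (F + \<Delta>F) (G + \<Delta>G) *\<^sub>v (u @\<^sub>v p) = (q + \<Delta>q) @\<^sub>v (r + \<Delta>r)}"

definition perturbation_size ::
  "real \<Rightarrow> real \<Rightarrow> real \<Rightarrow> real \<Rightarrow> real \<Rightarrow> perturbation \<Rightarrow> real" where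
  "perturbation_size \<alpha>\<^sub>1 \<alpha>\<^sub>2 \<alpha>\<^sub>3 \<beta>\<^sub>1 \<beta>\<^sub>2 = (\<lambda>(\<Delta>E, \<Delta>F, \<Delta>G, \<Delta>q, \<Delta>r).
     sqrt (\<alpha>\<^sub>1\<^sup>2 * (fnorm \<Delta>E)\<^sup>2 + \<alpha>\<^sub>2\<^sup>2 * (fnorm \<Delta>F)\<^sup>2 + \<alpha>\<^sub>3\<^sup>2 * (fnorm \<Delta>G)\<^sup>2
           + \<beta>\<^sub>1\<^sup>2 * (vnorm2 \<Delta>q)\<^sup>2 + \<beta>\<^sub>2\<^sup>2 * (vnorm2 \<Delta>r)\<^sup>2))"

text \<open>The least element of the set of sizes, i.e. the minimum (not merely the infimum); the value is
  only meaningful when the minimum is attained.\<close>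

definition backward_error_G1 ::
  "real \<Rightarrow> real \<Rightarrow> real \<Rightarrow> real \<Rightarrow> real \<Rightarrow>
   complex mat \<Rightarrow> complex mat \<Rightarrow> complex mat \<Rightarrow> complex vec \<Rightarrow> complex vec \<Rightarrow>
   complex vec \<Rightarrow> complex vec \<Rightarrow> real" where
  "backward_error_G1 \<alpha>\<^sub>1 \<alpha>\<^sub>2 \<alpha>\<^sub>3 \<beta>\<^sub>1 \<beta>\<^sub>2 E F G q r u p =
     (LEAST s. s \<in> perturbation_size \<alpha>\<^sub>1 \<alpha>\<^sub>2 \<alpha>\<^sub>3 \<beta>\<^sub>1 \<beta>\<^sub>2 ` perturbations_G1 E F G q r u p)"

section \<open>The coefficient matrix of the equivalent real system\<close>

definition Y1_hat :: "real \<Rightarrow> real \<Rightarrow> complex vec \<Rightarrow> complex vec \<Rightarrow> real mat" where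
  "Y1_hat \<alpha>\<^sub>1 \<alpha>\<^sub>2 u p = (let n = dim_vec u;
       u\<^sub>R = mat_of_row (Re_vec u); u\<^sub>I = mat_of_row (Im_vec u);
       p\<^sub>R = mat_of_row (Re_vec p); p\<^sub>I = mat_of_row (Im_vec p) in
     ( (1/\<alpha>\<^sub>1 \<cdot>\<^sub>m ((u\<^sub>R \<Otimes> 1\<^sub>m n) * J_S n * inv_mat (D_S n)))
       @\<^sub>c ((-1/\<alpha>\<^sub>1) \<cdot>\<^sub>m ((u\<^sub>I \<Otimes> 1\<^sub>m n) * J_SK n * inv_mat (D_SK n)))
       @\<^sub>c (1/\<alpha>\<^sub>2 \<cdot>\<^sub>m (1\<^sub>m n \<Otimes> p\<^sub>R))
       @\<^sub>c (1/\<alpha>\<^sub>2 \<cdot>\<^sub>m (1\<^sub>m n \<Otimes> p\<^sub>I)) )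
     @\<^sub>r
     ( (1/\<alpha>\<^sub>1 \<cdot>\<^sub>m ((u\<^sub>I \<Otimes> 1\<^sub>m n) * J_S n * inv_mat (D_S n)))
       @\<^sub>c (1/\<alpha>\<^sub>1 \<cdot>\<^sub>m ((u\<^sub>R \<Otimes> 1\<^sub>m n) * J_SK n * inv_mat (D_SK n)))
       @\<^sub>c (1/\<alpha>\<^sub>2 \<cdot>\<^sub>m (1\<^sub>m n \<Otimes> p\<^sub>I))
       @\<^sub>c ((-1/\<alpha>\<^sub>2) \<cdot>\<^sub>m (1\<^sub>m n \<Otimes> p\<^sub>R)) ))"

definition Y2_hat :: "real \<Rightarrow> real \<Rightarrow> complex vec \<Rightarrow> complex vec \<Rightarrow> real mat" where
  "Y2_hat \<alpha>\<^sub>2 \<alpha>\<^sub>3 u p = (let m = dim_vec p;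
       u\<^sub>R = mat_of_row (Re_vec u); u\<^sub>I = mat_of_row (Im_vec u);
       p\<^sub>R = mat_of_row (Re_vec p); p\<^sub>I = mat_of_row (Im_vec p) in
     ( (1/\<alpha>\<^sub>2 \<cdot>\<^sub>m (u\<^sub>R \<Otimes> 1\<^sub>m m))
       @\<^sub>c ((-1/\<alpha>\<^sub>2) \<cdot>\<^sub>m (u\<^sub>I \<Otimes> 1\<^sub>m m))
       @\<^sub>c (1/\<alpha>\<^sub>3 \<cdot>\<^sub>m (p\<^sub>R \<Otimes> 1\<^sub>m m))
       @\<^sub>c ((-1/\<alpha>\<^sub>3) \<cdot>\<^sub>m (p\<^sub>I \<Otimes> 1\<^sub>m m)) )
     @\<^sub>r
     ( (1/\<alpha>\<^sub>2 \<cdot>\<^sub>m (u\<^sub>I \<Otimes> 1\<^sub>m m))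
       @\<^sub>c (1/\<alpha>\<^sub>2 \<cdot>\<^sub>m (u\<^sub>R \<Otimes> 1\<^sub>m m))
       @\<^sub>c (1/\<alpha>\<^sub>3 \<cdot>\<^sub>m (p\<^sub>I \<Otimes> 1\<^sub>m m))
       @\<^sub>c (1/\<alpha>\<^sub>3 \<cdot>\<^sub>m (p\<^sub>R \<Otimes> 1\<^sub>m m)) ))"

definition Y1 :: "real \<Rightarrow> real \<Rightarrow> complex vec \<Rightarrow> complex vec \<Rightarrow> real mat" where
  "Y1 \<alpha>\<^sub>1 \<alpha>\<^sub>2 u p = Y1_hat \<alpha>\<^sub>1 \<alpha>\<^sub>2 u p @\<^sub>c 0\<^sub>m (2 * dim_vec u) (2 * (dim_vec p)\<^sup>2)"

definition Y2 :: "real \<Rightarrow> real \<Rightarrow> complex vec \<Rightarrow> complex vec \<Rightarrow> real mat" where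
  "Y2 \<alpha>\<^sub>2 \<alpha>\<^sub>3 u p = 0\<^sub>m (2 * dim_vec p) ((dim_vec u)\<^sup>2) @\<^sub>c Y2_hat \<alpha>\<^sub>2 \<alpha>\<^sub>3 u p"

definition I1 :: "real \<Rightarrow> nat \<Rightarrow> nat \<Rightarrow> real mat" where
  "I1 \<beta>\<^sub>1 n m = ((-1/\<beta>\<^sub>1) \<cdot>\<^sub>m 1\<^sub>m (2 * n)) @\<^sub>c 0\<^sub>m (2 * n) (2 * m)"

definition I2 :: "real \<Rightarrow> nat \<Rightarrow> nat \<Rightarrow> real mat" where
  "I2 \<beta>\<^sub>2 n m = 0\<^sub>m (2 * m) (2 * n) @\<^sub>c ((-1/\<beta>\<^sub>2) \<cdot>\<^sub>m 1\<^sub>m (2 * m))"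

end

theory Submission
  imports Defs
begin

text \<open>
  Scaling the real and imaginary parts of a perturbation by the weights, and storing the symmetric and
  skew-symmetric parts of the Hermitian block through their lower triangles (off-diagonal entries counted
  with weight \<open>sqrt 2\<close>), identifies the perturbations isometrically with a Euclidean space. The backward
  error constraint becomes a linear system \<open>M x = b\<close>, whose matrix has full row rank because of its two
  blocks \<open>-I/\<beta>\<close>. The minimum norm solution of such a system is \<open>M\<^sup>T (M M\<^sup>T)\<^sup>-\<^sup>1 b\<close>.
\<close>

text \<open>Conjugation is not complex linear, and Hermitian matrices form only a real vector space.
  The constraint, in which the perturbation of \<open>F\<close> also occurs conjugate transposed, is
  therefore linear over the reals only, so real and imaginary parts have to be separated throughout.
  The main obstacle is that several objects are given indirectly: \<open>J_S\<close> and
  \<open>J_SK\<close> by definite descriptions, \<open>D_S\<close> by a closed formula for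
  positions, \<open>inv_mat\<close> by an option value, the backward error by \<open>LEAST\<close>.
  Each has to be pinned down before it can be computed with. \<open>index_pairs\<close> is the
  common ground: with \<open>lo\<close> constantly 0, the column index or its successor, it lists
  the index pairs read by the full, the symmetric and the skew-symmetric vectorisation. Sums over
  positions can then be exchanged for sums over sets of pairs. The identification of perturbations
  with vectors has to be onto as well as norm preserving: otherwise the minimum norm solution would
  give only a lower bound.\<close>

section \<open>Enumerating matrix entries column by column\<close>

definition index_pairs :: "(nat \<Rightarrow> nat) \<Rightarrow> nat \<Rightarrow> nat \<Rightarrow> (nat \<times> nat) list" where
  "index_pairs lo r c = concat (map (\<lambda>j. map (\<lambda>i. (i, j)) [lo j..<r]) [0..<c])"

lemma index_pairs_0 [simp]: "index_pairs lo r 0 = []"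
  by (simp add: index_pairs_def)

lemma index_pairs_Suc [simp]: "index_pairs lo r (Suc c) = index_pairs lo r c @ map (\<lambda>i. (i, c)) [lo c..<r]"
  by (simp add: index_pairs_def)

lemma vec_cols_index_pairs: "vec_cols Z = vec_of_list (map (($$) Z) (index_pairs (\<lambda>_. 0) (dim_row Z) (dim_col Z)))"
  and vec_S_index_pairs: "vec_S Z = vec_of_list (map (($$) Z) (index_pairs (\<lambda>j. j) (dim_row Z) (dim_col Z)))"
  and vec_SK_index_pairs: "vec_SK Z = vec_of_list (map (($$) Z) (index_pairs Suc (dim_row Z) (dim_col Z)))"
  by (simp_all add: vec_cols_def vec_S_def vec_SK_def index_pairs_def map_concat comp_def)

lemma set_index_pairs: "set (index_pairs lo r c) = {(i, j). j < c \<and> lo j \<le> i \<and> i < r}"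
  by (auto simp: index_pairs_def)

lemma distinct_index_pairs: "distinct (index_pairs lo r c)"
  by (induction c) (auto simp: set_index_pairs distinct_map inj_on_def)

lemma length_index_pairs: "length (index_pairs lo r c) = (\<Sum>j<c. r - lo j)"
  by (induction c) auto

lemma length_index_pairs_cols [simp]: "length (index_pairs (\<lambda>_. 0) r c) = r * c"
  by (simp add: length_index_pairs)

text \<open>Column j of the lower triangle has k - j entries, so the first j columns hold k + (k -
  1) + ... + (k - j + 1) of them. For j < k this count is the 0-based position of the diagonal entry
  of column j, which is where the formula in \<open>D_S\<close> comes from. Doubling avoids the
  division. At j = k + 1 the additional column is empty and the formula still agrees; beyond that it
  fails.\<close>

lemma length_index_pairs_S_prefix: "j \<le> Suc k \<Longrightarrow> 2 * length (index_pairs (\<lambda>j. j) k j) = (2 * k + 1 - j) * j"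
proof (induction j)
  case (Suc j)
  then obtain d where k: "k = j + d" by (auto simp: le_iff_add)
  from Suc have "2 * length (index_pairs (\<lambda>j. j) k j) = (j + 2 * d + 1) * j"
    by (simp add: k)
  then show ?case
    by (simp add: k algebra_simps)
qed simp

lemma length_index_pairs_S [simp]: "length (index_pairs (\<lambda>j. j) k k) = k * (k + 1) div 2"
  using length_index_pairs_S_prefix[of k k] by (simp add: algebra_simps)

text \<open>Each column loses exactly its diagonal entry compared with the lower triangle, which
  leaves k(k+1)/2 - k entries.\<close>

lemma length_index_pairs_SK [simp]: "length (index_pairs Suc k k) = k * (k - 1) div 2"
proof -
  have "length (index_pairs (\<lambda>j. j) k c) = length (index_pairs Suc k c) + c" if "c \<le> k" for c
    using that by (induction c) auto
  from this[of k] have "2 * length (index_pairs Suc k k) + 2 * k = k * (k + 1)"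
    using length_index_pairs_S_prefix[of k k] by (simp add: algebra_simps)
  then have "2 * length (index_pairs Suc k k) = k * (k - 1)"
    by (cases k) (auto simp: algebra_simps)
  then show ?thesis by simp
qed

lemma dim_vec_cols [simp]: "dim_vec (vec_cols Z) = dim_row Z * dim_col Z"
  by (simp add: vec_cols_index_pairs)

lemma vec_cols_carrier [simp]: "Z \<in> carrier_mat r c \<Longrightarrow> vec_cols Z \<in> carrier_vec (r * c)"
  by (auto intro: carrier_vecI)

lemma vec_S_carrier [simp]: "Z \<in> carrier_mat k k \<Longrightarrow> vec_S Z \<in> carrier_vec (k * (k + 1) div 2)"
  by (auto simp: vec_S_index_pairs intro!: carrier_vecI)

lemma vec_SK_carrier [simp]: "Z \<in> carrier_mat k k \<Longrightarrow> vec_SK Z \<in> carrier_vec (k * (k - 1) div 2)"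
  by (auto simp: vec_SK_index_pairs intro!: carrier_vecI)

lemma sum_nth_distinct:
  assumes "distinct L"
  shows "(\<Sum>l<length L. f (L ! l)) = sum f (set L)"
  using assms by (simp add: sum.distinct_set_conv_list sum_list_sum_nth atLeast0LessThan)

lemma index_pairs_cols_nth: "l < r * c \<Longrightarrow> index_pairs (\<lambda>_. 0) r c ! l = (l mod r, l div r)"
proof (induction c)
  case (Suc c)
  show ?case
  proof (cases "l < r * c")
    case False
    then obtain d where d: "l = r * c + d" using less_eqE linorder_not_less by metis
    with Suc.prems have "d < r" by simp
    then show ?thesis by (simp add: nth_append d)
  qed (use Suc in \<open>simp add: nth_append\<close>)
qed simp

lemma vec_cols_index: "l < dim_row Z * dim_col Z \<Longrightarrow> vec_cols Z $ l = Z $$ (l mod dim_row Z, l div dim_row Z)"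
  by (simp add: vec_cols_index_pairs vec_of_list_index index_pairs_cols_nth)

text \<open>The enumeration by full columns meets every pair exactly once. Products with
  \<open>vec_cols\<close> and its norm are evaluated through this exchange of one linear index for a
  row and a column.\<close>

lemma sum_index_pairs_cols:
  fixes f :: "nat \<Rightarrow> nat \<Rightarrow> 'a::comm_monoid_add"
  shows "(\<Sum>l<r * c. f (l mod r) (l div r)) = (\<Sum>j<c. \<Sum>i<r. f i j)"
proof -
  let ?L = "index_pairs (\<lambda>_. 0) r c"
  have "(\<Sum>l<r * c. f (l mod r) (l div r)) = (\<Sum>l<length ?L. case_prod f (?L ! l))"
    by (intro sum.cong) (auto simp: index_pairs_cols_nth)
  also have "\<dots> = (\<Sum>(i, j)\<in>{..<r} \<times> {..<c}. f i j)"
    by (subst sum_nth_distinct[OF distinct_index_pairs]) (auto simp: set_index_pairs intro!: sum.cong)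
  also have "\<dots> = (\<Sum>j<c. \<Sum>i<r. f i j)"
    by (simp add: sum.cartesian_product[symmetric] sum.swap[of _ "{..<r}"])
  finally show ?thesis .
qed

section \<open>Kronecker products acting on vectorised matrices\<close>

text \<open>The identity vec(A X B) = (B^T \<otimes> A) vec(X), with A the identity matrix and B the
  single column x.\<close>

lemma kron_row_one_mult_vec_cols:
  fixes Z :: "'a::comm_ring_1 mat"
  assumes "Z \<in> carrier_mat k c" "x \<in> carrier_vec c"
  shows "(mat_of_row x \<Otimes> 1\<^sub>m k) *\<^sub>v vec_cols Z = Z *\<^sub>v x"
proof (rule eq_vecI)
  fix i assume "i < dim_vec (Z *\<^sub>v x)"
  then have i: "i < k" using assms by simp
  have "((mat_of_row x \<Otimes> 1\<^sub>m k) *\<^sub>v vec_cols Z) $ i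
      = (\<Sum>l<k * c. x $ (l div k) * (if i = l mod k then 1 else 0) * Z $$ (l mod k, l div k))"
    using assms i
    by (auto simp: kron_def scalar_prod_def vec_cols_index atLeast0LessThan mult.commute less_mult_imp_div_less intro!: sum.cong)
  also have "\<dots> = (\<Sum>j<c. \<Sum>a<k. x $ j * (if i = a then 1 else 0) * Z $$ (a, j))"
    by (rule sum_index_pairs_cols)
  also have "\<dots> = (\<Sum>j<c. x $ j * Z $$ (i, j))"
    using i by (simp add: sum.delta' if_distrib[of "\<lambda>y. _ * y * _"] cong: if_cong)
  also have "\<dots> = (Z *\<^sub>v x) $ i"
    using assms i by (simp add: scalar_prod_def atLeast0LessThan mult.commute)
  finally show "((mat_of_row x \<Otimes> 1\<^sub>m k) *\<^sub>v vec_cols Z) $ i = (Z *\<^sub>v x) $ i" .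
qed (use assms in \<open>simp add: kron_def\<close>)

lemma mat_of_row_index_mod:
  assumes "x \<in> carrier_vec r" "l < c * r"
  shows "mat_of_row x $$ (0, l mod r) = x $ (l mod r)"
  using assms by (cases "r = 0") auto

text \<open>The same identity with the single row x^T on the left and the identity matrix on the
  right. It lets a transposed matrix act although only the vectorisation of the matrix itself is
  stored, as needed for the conjugate transpose of the perturbation of \<open>F\<close>.\<close>

lemma kron_one_row_mult_vec_cols:
  fixes Z :: "'a::comm_ring_1 mat"
  assumes "Z \<in> carrier_mat r c" "x \<in> carrier_vec r"
  shows "(1\<^sub>m c \<Otimes> mat_of_row x) *\<^sub>v vec_cols Z = transpose_mat Z *\<^sub>v x"
proof (rule eq_vecI)
  fix j assume "j < dim_vec (transpose_mat Z *\<^sub>v x)"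
  then have j: "j < c" using assms by simp
  have "((1\<^sub>m c \<Otimes> mat_of_row x) *\<^sub>v vec_cols Z) $ j
      = (\<Sum>l<r * c. (if j = l div r then 1 else 0) * x $ (l mod r) * Z $$ (l mod r, l div r))"
    using assms j
    by (auto simp: kron_def scalar_prod_def vec_cols_index atLeast0LessThan mult.commute
        less_mult_imp_div_less mat_of_row_index_mod[OF assms(2)] intro!: sum.cong)
  also have "\<dots> = (\<Sum>b<c. \<Sum>i<r. (if j = b then 1 else 0) * x $ i * Z $$ (i, b))"
    by (rule sum_index_pairs_cols)
  also have "\<dots> = (\<Sum>b<c. if j = b then \<Sum>i<r. x $ i * Z $$ (i, b) else 0)"
    by (intro sum.cong) auto
  also have "\<dots> = (\<Sum>i<r. x $ i * Z $$ (i, j))"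
    using j by simp
  also have "\<dots> = (transpose_mat Z *\<^sub>v x) $ j"
    using assms j by (simp add: scalar_prod_def atLeast0LessThan mult.commute)
  finally show "((1\<^sub>m c \<Otimes> mat_of_row x) *\<^sub>v vec_cols Z) $ j = (transpose_mat Z *\<^sub>v x) $ j" .
qed (use assms in \<open>simp add: kron_def\<close>)

section \<open>Surjectivity of the three vectorisations\<close>

text \<open>In a distinct list an entry determines its position, so values prescribed by position
  define a function of the entries. This is how a matrix is filled from a vector.\<close>

lemma ex_nth_eq:
  assumes "distinct L"
  obtains f where "\<And>l. l < length L \<Longrightarrow> f (L ! l) = g l"
proof
  show "g (the_inv_into {..<length L} ((!) L) (L ! l)) = g l" if "l < length L" for l
    using that assms by (subst the_inv_into_f_f) (auto simp: inj_on_nth)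
qed

lemma ex_vec_cols:
  assumes "x \<in> carrier_vec (r * c)"
  obtains Z where "Z \<in> carrier_mat r c" "vec_cols Z = x"
proof -
  let ?L = "index_pairs (\<lambda>_. 0) r c"
  obtain f where f: "\<And>l. l < length ?L \<Longrightarrow> f (?L ! l) = x $ l"
    using ex_nth_eq[OF distinct_index_pairs] by metis
  have "mat r c f $$ (?L ! l) = x $ l" if "l < r * c" for l
    using that f[of l] nth_mem[of l ?L] by (auto simp: set_index_pairs)
  then have "vec_cols (mat r c f) = x"
    using assms by (intro eq_vecI) (auto simp: vec_cols_index_pairs vec_of_list_index)
  then show thesis by (intro that[of "mat r c f"]) auto
qed

lemma ex_vec_S:
  assumes "x \<in> carrier_vec (k * (k + 1) div 2)"
  obtains Z where "Z \<in> carrier_mat k k" "transpose_mat Z = Z" "vec_S Z = x"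
proof -
  let ?L = "index_pairs (\<lambda>j. j) k k"
  obtain f where f: "\<And>l. l < length ?L \<Longrightarrow> f (?L ! l) = x $ l"
    using ex_nth_eq[OF distinct_index_pairs] by metis
  \<comment> \<open>The pair of maximum and minimum is the representative of (i, j) in the lower
    triangle.\<close>
  let ?Z = "mat k k (\<lambda>(i, j). f (max i j, min i j))"
  have "?Z $$ (?L ! l) = x $ l" if "l < k * (k + 1) div 2" for l
    using that f[of l] nth_mem[of l ?L] by (auto simp: set_index_pairs max_def min_def split: if_splits)
  then have "vec_S ?Z = x"
    using assms by (intro eq_vecI) (auto simp: vec_S_index_pairs vec_of_list_index)
  moreover have "transpose_mat ?Z = ?Z"
    by (rule eq_matI) (auto simp: max.commute min.commute)
  ultimately show thesis by (intro that[of ?Z]) auto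
qed

lemma ex_vec_SK:
  fixes x :: "real vec"
  assumes "x \<in> carrier_vec (k * (k - 1) div 2)"
  obtains Z where "Z \<in> carrier_mat k k" "transpose_mat Z = - Z" "vec_SK Z = x"
proof -
  let ?L = "index_pairs Suc k k"
  obtain f where f: "\<And>l. l < length ?L \<Longrightarrow> f (?L ! l) = x $ l"
    using ex_nth_eq[OF distinct_index_pairs] by metis
  \<comment> \<open>The strict lower triangle is prescribed; skew symmetry forces the sign above the
    diagonal and the zeros on it.\<close>
  let ?Z = "mat k k (\<lambda>(i, j). if j < i then f (i, j) else if i < j then - f (j, i) else 0)"
  have "?Z $$ (?L ! l) = x $ l" if "l < k * (k - 1) div 2" for l
    using that f[of l] nth_mem[of l ?L] by (auto simp: set_index_pairs)
  then have "vec_SK ?Z = x"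
    using assms by (intro eq_vecI) (auto simp: vec_SK_index_pairs vec_of_list_index)
  moreover have "transpose_mat ?Z = - ?Z"
    by (rule eq_matI) auto
  ultimately show thesis by (intro that[of ?Z]) auto
qed

section \<open>The duplication matrices\<close>

lemma skew_symmetric_swap:
  fixes Z :: "real mat"
  assumes "Z \<in> carrier_mat k k" "transpose_mat Z = - Z" "i < k" "j < k"
  shows "Z $$ (j, i) = - Z $$ (i, j)"
  using arg_cong[OF assms(2), of "\<lambda>A. A $$ (i, j)"] assms(1,3,4) by simp

lemma symmetric_swap:
  assumes "Z \<in> carrier_mat k k" "transpose_mat Z = Z" "i < k" "j < k"
  shows "Z $$ (j, i) = Z $$ (i, j)"
  using arg_cong[OF assms(2), of "\<lambda>A. A $$ (i, j)"] assms(1,3,4) by simp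

lemma eq_mat_if_mult_vec_eq:
  fixes A B :: "'a::comm_ring_1 mat"
  assumes "A \<in> carrier_mat r c" "B \<in> carrier_mat r c"
    and eq: "\<And>x. x \<in> carrier_vec c \<Longrightarrow> A *\<^sub>v x = B *\<^sub>v x"
  shows "A = B"
proof (rule mat_col_eqI)
  fix i assume "i < dim_col B"
  then have i: "i < c" using assms by simp
  have "col C i = C *\<^sub>v unit_vec c i" if "C \<in> carrier_mat r c" for C :: "'a mat"
    using col_mult2[OF that one_carrier_mat i] that i by simp
  with assms show "col A i = col B i" by simp
qed (use assms in auto)

text \<open>Both duplication matrices have at most one nonzero entry per row: \<open>h\<close> is the position of the
  representative of an entry in the lower triangle, and \<open>s\<close> the sign relating the two entries.\<close>

lemma duplication_mat_mult_vec:
  fixes Z :: "real mat"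
  assumes Z: "Z \<in> carrier_mat k k" and L: "distinct L"
    and rep: "\<And>i j. i < k \<Longrightarrow> j < k \<Longrightarrow>
      Z $$ (i, j) = (if h (i, j) \<in> set L then s (i, j) * Z $$ h (i, j) else 0)"
  shows "mat (k\<^sup>2) (length L) (\<lambda>(a, l). if L ! l = h (a mod k, a div k) then s (a mod k, a div k) else 0)
      *\<^sub>v vec_of_list (map (($$) Z) L) = vec_cols Z" (is "?J *\<^sub>v ?v = _")
proof (rule eq_vecI)
  fix a assume "a < dim_vec (vec_cols Z)"
  then have a: "a < k * k" using Z by simp
  then have ak: "a mod k < k" "a div k < k"
    by (auto simp: less_mult_imp_div_less intro!: mod_less_divisor Nat.gr0I)
  let ?p = "(a mod k, a div k)"
  have "(?J *\<^sub>v ?v) $ a = (\<Sum>l<length L. (if L ! l = h ?p then s ?p else 0) * Z $$ (L ! l))"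
    using a by (simp add: scalar_prod_def power2_eq_square vec_of_list_index atLeast0LessThan)
  also have "\<dots> = (\<Sum>e\<in>set L. (if e = h ?p then s ?p else 0) * Z $$ e)"
    by (rule sum_nth_distinct[OF L])
  also have "\<dots> = (\<Sum>e\<in>set L. if e = h ?p then s ?p * Z $$ h ?p else 0)"
    by (intro sum.cong) auto
  also have "\<dots> = Z $$ ?p"
    using rep[OF ak] by simp
  also have "\<dots> = vec_cols Z $ a"
    using Z a by (simp add: vec_cols_index)
  finally show "(?J *\<^sub>v ?v) $ a = vec_cols Z $ a" .
qed (use Z in \<open>simp add: power2_eq_square\<close>)

text \<open>The definite description is usable only after existence and uniqueness. The 0/1
  duplication matrix is a witness. Uniqueness holds because \<open>vec_S\<close> attains every
  vector on symmetric matrices, so the condition fixes the action of \<open>J\<close> on the whole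
  space.\<close>

lemma J_S:
  shows J_S_carrier [simp]: "J_S k \<in> carrier_mat (k\<^sup>2) (k * (k + 1) div 2)"
    and J_S_mult_vec_S: "Z \<in> carrier_mat k k \<Longrightarrow> transpose_mat Z = Z \<Longrightarrow> J_S k *\<^sub>v vec_S Z = vec_cols Z"
proof -
  let ?P = "\<lambda>J :: real mat. J \<in> carrier_mat (k\<^sup>2) (k * (k + 1) div 2) \<and>
     (\<forall>Z \<in> carrier_mat k k. transpose_mat Z = Z \<longrightarrow> vec_cols Z = J *\<^sub>v vec_S Z)"
  let ?L = "index_pairs (\<lambda>j. j) k k" and ?h = "\<lambda>(i, j). (max i j, min i j) :: nat \<times> nat"
  have "\<exists>!J. ?P J"
  proof (rule ex_ex1I)
    let ?J = "mat (k\<^sup>2) (length ?L) (\<lambda>(a, l). if ?L ! l = ?h (a mod k, a div k) then 1 else 0) :: real mat"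
    have "?J *\<^sub>v vec_S Z = vec_cols Z" if "Z \<in> carrier_mat k k" "transpose_mat Z = Z" for Z
      using duplication_mat_mult_vec[OF that(1) distinct_index_pairs[of "\<lambda>j. j" k k], of ?h "\<lambda>_. 1"] that symmetric_swap[OF that]
      by (force simp: vec_S_index_pairs set_index_pairs max_def min_def)
    then show "\<exists>J. ?P J" by (intro exI[of _ ?J]) auto
  next
    fix A B assume AB: "?P A" "?P B"
    show "A = B"
    proof (rule eq_mat_if_mult_vec_eq)
      fix x :: "real vec" assume "x \<in> carrier_vec (k * (k + 1) div 2)"
      then obtain Z where "Z \<in> carrier_mat k k" "transpose_mat Z = Z" "vec_S Z = x"
        by (rule ex_vec_S)
      with AB show "A *\<^sub>v x = B *\<^sub>v x" by metis
    qed (use AB in blast)+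
  qed
  from theI'[OF this] have "?P (J_S k)" unfolding J_S_def .
  then show "J_S k \<in> carrier_mat (k\<^sup>2) (k * (k + 1) div 2)"
    and "Z \<in> carrier_mat k k \<Longrightarrow> transpose_mat Z = Z \<Longrightarrow> J_S k *\<^sub>v vec_S Z = vec_cols Z"
    by auto
qed

text \<open>The scheme is that of the symmetric case, with sign -1 above the diagonal. A diagonal
  pair is its own representative and is missing from the strict triangle, so its row in the
  duplication matrix vanishes, in accordance with the zero diagonal of a skew-symmetric
  matrix.\<close>

lemma J_SK:
  shows J_SK_carrier [simp]: "J_SK k \<in> carrier_mat (k\<^sup>2) (k * (k - 1) div 2)"
    and J_SK_mult_vec_SK: "Z \<in> carrier_mat k k \<Longrightarrow> transpose_mat Z = - Z \<Longrightarrow> J_SK k *\<^sub>v vec_SK Z = vec_cols Z"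
proof -
  let ?P = "\<lambda>J :: real mat. J \<in> carrier_mat (k\<^sup>2) (k * (k - 1) div 2) \<and>
     (\<forall>Z \<in> carrier_mat k k. transpose_mat Z = - Z \<longrightarrow> vec_cols Z = J *\<^sub>v vec_SK Z)"
  let ?L = "index_pairs Suc k k" and ?h = "\<lambda>(i, j). (max i j, min i j) :: nat \<times> nat"
    and ?s = "\<lambda>(i, j). if j < (i::nat) then 1 else - 1 :: real"
  have "\<exists>!J. ?P J"
  proof (rule ex_ex1I)
    let ?J = "mat (k\<^sup>2) (length ?L) (\<lambda>(a, l). if ?L ! l = ?h (a mod k, a div k) then ?s (a mod k, a div k) else 0) :: real mat"
    have "?J *\<^sub>v vec_SK Z = vec_cols Z" if "Z \<in> carrier_mat k k" "transpose_mat Z = - Z" for Z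
    proof -
      have "Z $$ (i, j) = (if ?h (i, j) \<in> set ?L then ?s (i, j) * Z $$ ?h (i, j) else 0)"
        if "i < k" "j < k" for i j
        using that skew_symmetric_swap[OF \<open>Z \<in> _\<close> \<open>transpose_mat Z = _\<close> that]
        by (auto simp: set_index_pairs max_def min_def not_less_eq_eq)
      with duplication_mat_mult_vec[OF that(1) distinct_index_pairs[of Suc k k], of ?h ?s] that
      show ?thesis
        by (simp add: vec_SK_index_pairs)
    qed
    then show "\<exists>J. ?P J" by (intro exI[of _ ?J]) auto
  next
    fix A B assume AB: "?P A" "?P B"
    show "A = B"
    proof (rule eq_mat_if_mult_vec_eq)
      fix x :: "real vec" assume "x \<in> carrier_vec (k * (k - 1) div 2)"
      then obtain Z where "Z \<in> carrier_mat k k" "transpose_mat Z = - Z" "vec_SK Z = x"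
        by (rule ex_vec_SK)
      with AB show "A *\<^sub>v x = B *\<^sub>v x" by metis
    qed (use AB in blast)+
  qed
  from theI'[OF this] have "?P (J_SK k)" unfolding J_SK_def .
  then show "J_SK k \<in> carrier_mat (k\<^sup>2) (k * (k - 1) div 2)"
    and "Z \<in> carrier_mat k k \<Longrightarrow> transpose_mat Z = - Z \<Longrightarrow> J_SK k *\<^sub>v vec_SK Z = vec_cols Z"
    by auto
qed

section \<open>Euclidean and Frobenius norms\<close>

lemma smult_mat_mult_vec:
  fixes A :: "'a::comm_ring_1 mat"
  assumes "A \<in> carrier_mat r c" "v \<in> carrier_vec c"
  shows "(a \<cdot>\<^sub>m A) *\<^sub>v v = a \<cdot>\<^sub>v (A *\<^sub>v v)"
  using assms by (intro eq_vecI) (auto simp: scalar_prod_def sum_distrib_left mult.assoc)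

lemma vnorm2_sq: "(vnorm2 v)\<^sup>2 = (\<Sum>i<dim_vec v. (norm (v $ i))\<^sup>2)"
  by (simp add: vnorm2_def sum_nonneg)

lemma fnorm_sq: "(fnorm A)\<^sup>2 = (\<Sum>i<dim_row A. \<Sum>j<dim_col A. (norm (A $$ (i, j)))\<^sup>2)"
  by (simp add: fnorm_def sum_nonneg)

lemma vnorm2_nonneg [simp]: "0 \<le> vnorm2 v"
  by (simp add: vnorm2_def sum_nonneg)

lemma vnorm2_sq_append: "(vnorm2 (v @\<^sub>v w))\<^sup>2 = (vnorm2 v)\<^sup>2 + (vnorm2 w)\<^sup>2"
proof -
  have "sum g {..<a + b} = sum g {..<a} + (\<Sum>i<b. g (a + i))" for g :: "nat \<Rightarrow> real" and a b
    by (induction b) auto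
  then show ?thesis by (simp add: vnorm2_sq)
qed

lemma vnorm2_sq_smult:
  fixes v :: "real vec"
  shows "(vnorm2 (a \<cdot>\<^sub>v v))\<^sup>2 = a\<^sup>2 * (vnorm2 v)\<^sup>2"
  by (simp add: vnorm2_sq sum_distrib_left power_mult_distrib)

lemma vnorm2_sq_scalar_prod:
  fixes v :: "real vec"
  shows "(vnorm2 v)\<^sup>2 = v \<bullet> v"
  by (simp add: vnorm2_sq scalar_prod_def atLeast0LessThan) (simp add: power2_eq_square)

lemma vnorm2_sq_vec_cols: "(vnorm2 (vec_cols Z))\<^sup>2 = (fnorm Z)\<^sup>2"
proof -
  have "(vnorm2 (vec_cols Z))\<^sup>2
      = (\<Sum>l<dim_row Z * dim_col Z. (norm (Z $$ (l mod dim_row Z, l div dim_row Z)))\<^sup>2)"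
    by (simp add: vnorm2_sq vec_cols_index)
  also have "\<dots> = (\<Sum>j<dim_col Z. \<Sum>i<dim_row Z. (norm (Z $$ (i, j)))\<^sup>2)"
    by (rule sum_index_pairs_cols)
  also have "\<dots> = (fnorm Z)\<^sup>2"
    by (simp add: fnorm_sq sum.swap[of _ "{..<dim_col Z}"])
  finally show ?thesis .
qed

lemma vnorm2_sq_complex: "(vnorm2 v)\<^sup>2 = (vnorm2 (Re_vec v))\<^sup>2 + (vnorm2 (Im_vec v))\<^sup>2"
  by (simp add: vnorm2_sq cmod_power2 sum.distrib)

lemma fnorm_sq_complex: "(fnorm A)\<^sup>2 = (fnorm (map_mat Re A))\<^sup>2 + (fnorm (map_mat Im A))\<^sup>2"
  by (simp add: fnorm_sq cmod_power2 sum.distrib)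

section \<open>Inverses, Gram matrices and minimum norm solutions\<close>

text \<open>For square matrices a right inverse is two-sided, so \<open>A\<close> is a unit of the
  matrix ring and \<open>mat_inverse\<close> returns \<open>Some\<close>. Exhibiting any right
  inverse is thus enough to give \<open>inv_mat\<close> its meaning.\<close>

lemma inv_mat:
  fixes A :: "'a::field mat"
  assumes "A \<in> carrier_mat n n" "B \<in> carrier_mat n n" "A * B = 1\<^sub>m n"
  shows inv_mat_carrier: "inv_mat A \<in> carrier_mat n n"
    and inv_mat_mult_left: "inv_mat A * A = 1\<^sub>m n"
    and inv_mat_mult_right: "A * inv_mat A = 1\<^sub>m n"
proof -
  have "B * A = 1\<^sub>m n"
    using mat_mult_left_right_inverse assms by blast
  with assms have "A \<in> Units (ring_mat TYPE('a) n ())"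
    by (auto simp: Units_def ring_mat_def)
  then obtain C where "mat_inverse A = Some C"
    using mat_inverse(1)[OF assms(1), where b = "()"] by (cases "mat_inverse A") auto
  with mat_inverse(2)[OF assms(1) this] show "inv_mat A \<in> carrier_mat n n"
    "inv_mat A * A = 1\<^sub>m n" "A * inv_mat A = 1\<^sub>m n"
    by (auto simp: inv_mat_def)
qed

lemma scalar_prod_self_eq_0_iff:
  fixes v :: "real vec"
  assumes "v \<in> carrier_vec n"
  shows "v \<bullet> v = 0 \<longleftrightarrow> v = 0\<^sub>v n"
proof
  assume "v \<bullet> v = 0"
  then have "\<forall>i<n. v $ i = 0"
    using assms by (auto simp: scalar_prod_def sum_nonneg_eq_0_iff)
  then show "v = 0\<^sub>v n" using assms by (intro eq_vecI) auto
qed (simp add: scalar_prod_def)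

text \<open>Full row rank enters as solvability for every right-hand side. If M M^T v = 0, then w =
  M^T v satisfies w . w = v . (M w) = 0, so w = 0. Writing v = M x gives v . v = w . x = 0. The
  kernel is trivial and the determinant nonzero.\<close>

lemma gram_mat_inverse:
  fixes M :: "real mat"
  assumes M: "M \<in> carrier_mat N K"
    and surj: "\<And>b. b \<in> carrier_vec N \<Longrightarrow> \<exists>x \<in> carrier_vec K. M *\<^sub>v x = b"
  obtains B where "B \<in> carrier_mat N N" "M * transpose_mat M * B = 1\<^sub>m N"
proof -
  let ?A = "M * transpose_mat M"
  have A: "?A \<in> carrier_mat N N" using M by auto
  have "v = 0\<^sub>v N" if v: "v \<in> carrier_vec N" and Av: "?A *\<^sub>v v = 0\<^sub>v N" for v
  proof -
    let ?w = "transpose_mat M *\<^sub>v v"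
    have w: "?w \<in> carrier_vec K" using M v by auto
    have "?w \<bullet> ?w = v \<bullet> (M *\<^sub>v ?w)"
      using transpose_vec_mult_scalar[OF M w v] .
    also have "M *\<^sub>v ?w = 0\<^sub>v N"
      using Av M v by (simp add: assoc_mult_mat_vec[of _ N K _ N])
    finally have w0: "?w = 0\<^sub>v K"
      using scalar_prod_self_eq_0_iff[OF w] v by simp
    from surj[OF v] obtain x where x: "x \<in> carrier_vec K" "M *\<^sub>v x = v" by blast
    have "v \<bullet> v = ?w \<bullet> x"
      using transpose_vec_mult_scalar[OF M x(1) v] x by simp
    then show ?thesis
      using w0 x scalar_prod_self_eq_0_iff[OF v] by simp
  qed
  then have "det ?A \<noteq> 0"
    using det_0_iff_vec_prod_zero_field[OF A] by blast
  from det_non_zero_imp_unit[OF A this, of "()"] obtain B where "B \<in> carrier_mat N N" "?A * B = 1\<^sub>m N"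
    by (auto simp: Units_def ring_mat_def)
  then show thesis by (rule that)
qed

text \<open>\<open>x0\<close> lies in the range of M^T and is therefore orthogonal to the kernel of
  \<open>M\<close>. Any other solution differs from it by a kernel vector, and Pythagoras gives the
  inequality.\<close>

lemma least_norm_solution:
  fixes M :: "real mat"
  assumes M: "M \<in> carrier_mat N K"
    and B: "B \<in> carrier_mat N N" "M * transpose_mat M * B = 1\<^sub>m N"
    and b: "b \<in> carrier_vec N"
  defines "x0 \<equiv> (transpose_mat M * B) *\<^sub>v b"
  shows "x0 \<in> carrier_vec K" and "M *\<^sub>v x0 = b"
    and "\<And>x. x \<in> carrier_vec K \<Longrightarrow> M *\<^sub>v x = b \<Longrightarrow> vnorm2 x0 \<le> vnorm2 x"
proof -
  have Bb: "B *\<^sub>v b \<in> carrier_vec N" using B b by auto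
  have x0: "x0 = transpose_mat M *\<^sub>v (B *\<^sub>v b)"
    using M B b by (simp add: x0_def assoc_mult_mat_vec[of _ K N _ N])
  then show c0: "x0 \<in> carrier_vec K" using M Bb by auto
  have "M *\<^sub>v x0 = (M * (transpose_mat M * B)) *\<^sub>v b"
    using M B(1) b by (simp add: x0_def assoc_mult_mat_vec[of _ N K _ N])
  also have "M * (transpose_mat M * B) = M * transpose_mat M * B"
    using M B by (simp add: assoc_mult_mat[of _ N K _ N _ N])
  finally show M0: "M *\<^sub>v x0 = b" unfolding B(2) using b by simp
  fix x assume x: "x \<in> carrier_vec K" "M *\<^sub>v x = b"
  define d where "d = x - x0"
  have d: "d \<in> carrier_vec K" and xd: "x = x0 + d" using x c0 by (auto simp: d_def)
  have "M *\<^sub>v d = 0\<^sub>v N"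
    using M x c0 M0 b by (simp add: d_def mult_minus_distrib_mat_vec)
  then have "x0 \<bullet> d = 0"
    using transpose_vec_mult_scalar[OF M d Bb] Bb by (simp add: x0)
  then have "(vnorm2 x)\<^sup>2 = (vnorm2 x0)\<^sup>2 + (vnorm2 d)\<^sup>2"
    using c0 d comm_scalar_prod[OF c0 d]
    by (simp add: xd vnorm2_sq_scalar_prod scalar_prod_add_distrib[of _ K] add_scalar_prod_distrib[of _ K])
  then show "vnorm2 x0 \<le> vnorm2 x"
    by (metis le_add_same_cancel1 power2_le_imp_le vnorm2_nonneg zero_le_power2)
qed

section \<open>The diagonal weights and the Frobenius norm\<close>

lemma index_pairs_prefix: "j \<le> c \<Longrightarrow> \<exists>ys. index_pairs lo r c = index_pairs lo r j @ ys"
  by (induction c) (auto simp: le_Suc_eq)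

text \<open>Column j of the lower triangle opens with its diagonal entry, which therefore directly
  follows all entries of the preceding columns.\<close>

lemma index_pairs_S_nth_diag:
  assumes "j < k"
  shows "length (index_pairs (\<lambda>j. j) k j) < length (index_pairs (\<lambda>j. j) k k)"
    and "index_pairs (\<lambda>j. j) k k ! length (index_pairs (\<lambda>j. j) k j) = (j, j)"
  using index_pairs_prefix[of "Suc j" k "\<lambda>j. j" k] assms
  by (auto simp: nth_append simp del: length_index_pairs_S)

text \<open>For the 1-based index i the closed formula counts the entries of the first i - 1
  columns, which is the position of the pair (i-1, i-1). Distinctness of the enumeration gives the
  converse. In this form the weight depends on the index pair alone, as a sum over pairs
  requires.\<close>

lemma D_S_diag:
  "D_S k = mat_diag (k * (k + 1) div 2)
     (\<lambda>l. if case_prod (=) (index_pairs (\<lambda>j. j) k k ! l) then 1 else sqrt 2)"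
proof -
  let ?L = "index_pairs (\<lambda>j. j) k k"
  have pos: "(2 * k + 2 - i) * (i - 1) div 2 = length (index_pairs (\<lambda>j. j) k (i - 1))"
    if "i \<in> {1..k}" for i
    using that length_index_pairs_S_prefix[of "i - 1" k] by (cases i) auto
  have "(\<exists>i\<in>{1..k}. l + 1 = (2 * k + 2 - i) * (i - 1) div 2 + 1) \<longleftrightarrow> case_prod (=) (?L ! l)"
    if l: "l < k * (k + 1) div 2" for l
  proof
    assume "\<exists>i\<in>{1..k}. l + 1 = (2 * k + 2 - i) * (i - 1) div 2 + 1"
    then obtain i where "i \<in> {1..k}" "l = length (index_pairs (\<lambda>j. j) k (i - 1))"
      using pos by auto
    then show "case_prod (=) (?L ! l)"
      using index_pairs_S_nth_diag(2)[of "i - 1" k] by auto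
  next
    assume "case_prod (=) (?L ! l)"
    moreover have "?L ! l \<in> set ?L" using l by simp
    ultimately obtain j where j: "j < k" "?L ! l = (j, j)" by (auto simp: set_index_pairs)
    then have "l = length (index_pairs (\<lambda>j. j) k j)"
      using nth_eq_iff_index_eq[OF distinct_index_pairs, of l "\<lambda>j. j" k k "length (index_pairs (\<lambda>j. j) k j)"]
        index_pairs_S_nth_diag[OF j(1)] l by simp
    with j(1) pos[of "Suc j"] show "\<exists>i\<in>{1..k}. l + 1 = (2 * k + 2 - i) * (i - 1) div 2 + 1"
      by (intro bexI[of _ "Suc j"]) auto
  qed
  then show ?thesis
    unfolding D_S_def mat_diag_def by (intro eq_matI) auto
qed

lemma mat_diag_mult_vec:
  fixes v :: "'a::semiring_0 vec"
  assumes "v \<in> carrier_vec N"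
  shows "mat_diag N d *\<^sub>v v = vec N (\<lambda>i. d i * v $ i)"
  using assms
  by (intro eq_vecI) (auto simp: mat_diag_def scalar_prod_def sum.delta' if_distrib[of "\<lambda>y. y * _"] cong: if_cong)

lemma D_S_carrier [simp]: "D_S k \<in> carrier_mat (k * (k + 1) div 2) (k * (k + 1) div 2)"
  by (simp add: D_S_def)

lemma D_SK_carrier [simp]: "D_SK k \<in> carrier_mat (k * (k - 1) div 2) (k * (k - 1) div 2)"
  by (simp add: D_SK_def)

lemma inv_D_S:
  shows inv_D_S_carrier [simp]: "inv_mat (D_S k) \<in> carrier_mat (k * (k + 1) div 2) (k * (k + 1) div 2)"
    and inv_D_S_mult: "inv_mat (D_S k) * D_S k = 1\<^sub>m (k * (k + 1) div 2)"
    and D_S_mult_inv: "D_S k * inv_mat (D_S k) = 1\<^sub>m (k * (k + 1) div 2)"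
proof -
  define d where "d l = (if case_prod (=) (index_pairs (\<lambda>j. j) k k ! l) then 1 else sqrt 2)" for l
  let ?N = "k * (k + 1) div 2"
  have D: "D_S k = mat_diag ?N d"
    by (simp only: D_S_diag d_def[abs_def])
  then have "D_S k * mat_diag ?N (\<lambda>l. inverse (d l)) = 1\<^sub>m ?N"
    by (simp add: d_def)
  from inv_mat[OF D_S_carrier mat_diag_dim this]
  show "inv_mat (D_S k) \<in> carrier_mat ?N ?N" "inv_mat (D_S k) * D_S k = 1\<^sub>m ?N"
    "D_S k * inv_mat (D_S k) = 1\<^sub>m ?N" .
qed

lemma inv_D_SK:
  shows inv_D_SK_carrier [simp]: "inv_mat (D_SK k) \<in> carrier_mat (k * (k - 1) div 2) (k * (k - 1) div 2)"
    and inv_D_SK_mult: "inv_mat (D_SK k) * D_SK k = 1\<^sub>m (k * (k - 1) div 2)"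
    and D_SK_mult_inv: "D_SK k * inv_mat (D_SK k) = 1\<^sub>m (k * (k - 1) div 2)"
proof -
  have "D_SK k * ((1 / sqrt 2) \<cdot>\<^sub>m 1\<^sub>m (k * (k - 1) div 2)) = 1\<^sub>m (k * (k - 1) div 2)"
    by (intro eq_matI) (auto simp: D_SK_def mult_smult_distrib[of _ _ "k * (k - 1) div 2"]
      mult_smult_assoc_mat[of _ _ "k * (k - 1) div 2"])
  from inv_mat[OF D_SK_carrier _ this]
  show "inv_mat (D_SK k) \<in> carrier_mat (k * (k - 1) div 2) (k * (k - 1) div 2)"
    "inv_mat (D_SK k) * D_SK k = 1\<^sub>m (k * (k - 1) div 2)"
    "D_SK k * inv_mat (D_SK k) = 1\<^sub>m (k * (k - 1) div 2)"
    by auto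
qed

text \<open>The index square is the disjoint union of the diagonal, the strict lower triangle and
  its mirror image, and the last two contribute equally when \<open>g\<close> is symmetric. The
  first form serves the strict triangle, the second the triangle with its diagonal.\<close>

lemma sum_square_split:
  fixes g :: "nat \<Rightarrow> nat \<Rightarrow> real"
  assumes "\<And>i j. i < k \<Longrightarrow> j < k \<Longrightarrow> g j i = g i j"
  shows "(\<Sum>i<k. \<Sum>j<k. g i j) = (\<Sum>i<k. g i i) + 2 * (\<Sum>(i, j)\<in>set (index_pairs Suc k k). g i j)"
    and "(\<Sum>i<k. \<Sum>j<k. g i j) = (\<Sum>(i, j)\<in>set (index_pairs (\<lambda>j. j) k k). (if i = j then 1 else 2) * g i j)"
proof -
  let ?D = "(\<lambda>i. (i, i)) ` {..<k}" and ?L = "set (index_pairs Suc k k)"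
  have disj: "?D \<inter> (?L \<union> prod.swap ` ?L) = {}" "?L \<inter> prod.swap ` ?L = {}" "?D \<inter> ?L = {}"
    by (auto simp: set_index_pairs)
  have "(\<Sum>i<k. \<Sum>j<k. g i j) = sum (case_prod g) (?D \<union> (?L \<union> prod.swap ` ?L))"
    unfolding sum.cartesian_product by (rule sum.cong) (auto simp: set_index_pairs image_iff)
  also have "\<dots> = sum (case_prod g) ?D + (sum (case_prod g) ?L + sum (case_prod g) (prod.swap ` ?L))"
    by (simp add: sum.union_disjoint disj)
  also have "sum (case_prod g) (prod.swap ` ?L) = sum (case_prod g) ?L"
    by (subst sum.reindex) (auto simp: set_index_pairs assms intro!: sum.cong)
  also have "sum (case_prod g) ?D = (\<Sum>i<k. g i i)"
    by (subst sum.reindex) (auto simp: inj_on_def)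
  finally show eq: "(\<Sum>i<k. \<Sum>j<k. g i j) = (\<Sum>i<k. g i i) + 2 * (\<Sum>(i, j)\<in>?L. g i j)" by simp
  have "(\<Sum>(i, j)\<in>set (index_pairs (\<lambda>j. j) k k). (if i = j then 1 else 2) * g i j)
      = (\<Sum>(i, j)\<in>?D \<union> ?L. (if i = j then 1 else 2) * g i j)"
    by (rule sum.cong) (auto simp: set_index_pairs)
  also have "\<dots> = (\<Sum>(i, j)\<in>?D. (if i = j then 1 else 2) * g i j) + (\<Sum>(i, j)\<in>?L. (if i = j then 1 else 2) * g i j)"
    by (rule sum.union_disjoint) (auto simp: disj)
  also have "(\<Sum>(i, j)\<in>?D. (if i = j then 1 else 2) * g i j) = (\<Sum>i<k. g i i)"
    by (subst sum.reindex) (auto simp: inj_on_def)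
  also have "(\<Sum>(i, j)\<in>?L. (if i = j then 1 else 2) * g i j) = 2 * (\<Sum>(i, j)\<in>?L. g i j)"
    unfolding sum_distrib_left by (rule sum.cong) (auto simp: set_index_pairs)
  finally show "(\<Sum>i<k. \<Sum>j<k. g i j) = (\<Sum>(i, j)\<in>set (index_pairs (\<lambda>j. j) k k). (if i = j then 1 else 2) * g i j)"
    using eq by simp
qed

text \<open>Squared, the weights are 1 on the diagonal and 2 elsewhere: an entry off the diagonal
  stands for itself and its mirror image, which has the same square.\<close>

lemma vnorm2_sq_D_S:
  assumes Z: "Z \<in> carrier_mat k k" "transpose_mat Z = Z"
  shows "(vnorm2 (D_S k *\<^sub>v vec_S Z))\<^sup>2 = (fnorm Z)\<^sup>2"
proof -
  let ?L = "index_pairs (\<lambda>j. j) k k"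
  have "D_S k *\<^sub>v vec_S Z
      = vec (length ?L) (\<lambda>l. (if case_prod (=) (?L ! l) then 1 else sqrt 2) * vec_S Z $ l)"
    unfolding D_S_diag length_index_pairs_S by (rule mat_diag_mult_vec[OF vec_S_carrier[OF Z(1)]])
  then have "(vnorm2 (D_S k *\<^sub>v vec_S Z))\<^sup>2
      = (\<Sum>l<length ?L. (if case_prod (=) (?L ! l) then 1 else 2) * (Z $$ (?L ! l))\<^sup>2)"
    using Z by (auto simp: vnorm2_sq power_mult_distrib vec_S_index_pairs
        vec_of_list_index intro!: sum.cong)
  also have "\<dots> = (\<Sum>(i, j)\<in>set ?L. (if i = j then 1 else 2) * (Z $$ (i, j))\<^sup>2)"
    by (subst sum_nth_distinct[OF distinct_index_pairs]) (auto intro!: sum.cong)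
  also have "\<dots> = (\<Sum>i<k. \<Sum>j<k. (Z $$ (i, j))\<^sup>2)"
    by (rule sum_square_split(2)[symmetric]) (simp add: symmetric_swap[OF Z])
  also have "\<dots> = (fnorm Z)\<^sup>2" using Z by (simp add: fnorm_sq)
  finally show ?thesis .
qed

lemma vnorm2_sq_D_SK:
  assumes Z: "Z \<in> carrier_mat k k" "transpose_mat Z = - Z"
  shows "(vnorm2 (D_SK k *\<^sub>v vec_SK Z))\<^sup>2 = (fnorm Z)\<^sup>2"
proof -
  let ?L = "index_pairs Suc k k"
  have diag: "Z $$ (i, i) = 0" if "i < k" for i
    using skew_symmetric_swap[OF Z that that] by simp
  have "D_SK k *\<^sub>v vec_SK Z = sqrt 2 \<cdot>\<^sub>v vec_SK Z"
    using smult_mat_mult_vec[OF one_carrier_mat vec_SK_carrier[OF Z(1)]] one_mult_mat_vec[OF vec_SK_carrier[OF Z(1)]]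
    by (simp only: D_SK_def)
  then have "(vnorm2 (D_SK k *\<^sub>v vec_SK Z))\<^sup>2 = 2 * (\<Sum>l<length ?L. (Z $$ (?L ! l))\<^sup>2)"
    using Z by (simp add: vnorm2_sq_smult) (simp add: vnorm2_sq vec_SK_index_pairs vec_of_list_index)
  also have "\<dots> = 2 * (\<Sum>(i, j)\<in>set ?L. (Z $$ (i, j))\<^sup>2)"
    by (subst sum_nth_distinct[OF distinct_index_pairs]) (auto intro!: sum.cong)
  also have "\<dots> = (\<Sum>i<k. (Z $$ (i, i))\<^sup>2) + 2 * (\<Sum>(i, j)\<in>set ?L. (Z $$ (i, j))\<^sup>2)"
    by (simp add: diag)
  \<comment> \<open>The entries change sign under reflection, but their squares are symmetric, so
    the splitting of the square applies.\<close>
  also have "\<dots> = (\<Sum>i<k. \<Sum>j<k. (Z $$ (i, j))\<^sup>2)"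
    by (rule sum_square_split(1)[symmetric]) (subst skew_symmetric_swap[OF Z], simp_all)
  also have "\<dots> = (fnorm Z)\<^sup>2" using Z by (simp add: fnorm_sq)
  finally show ?thesis .
qed

section \<open>Products of block matrices with stacked vectors\<close>

lemma append_cols_carrier [simp]:
  "A \<in> carrier_mat r c1 \<Longrightarrow> B \<in> carrier_mat r c2 \<Longrightarrow> A @\<^sub>c B \<in> carrier_mat r (c1 + c2)"
  unfolding append_cols_def by (intro carrier_matI) auto

text \<open>\<open>append_cols\<close> is a block matrix whose two lower blocks have no rows, so the
  block product ends in a vector of length 0, which disappears.\<close>

lemma append_cols_mult_vec:
  fixes A :: "'a::comm_ring_1 mat"
  assumes "A \<in> carrier_mat r c1" "B \<in> carrier_mat r c2" "v \<in> carrier_vec c1" "w \<in> carrier_vec c2"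
  shows "(A @\<^sub>c B) *\<^sub>v (v @\<^sub>v w) = A *\<^sub>v v + B *\<^sub>v w"
proof -
  have "(A @\<^sub>c B) *\<^sub>v (v @\<^sub>v w) = (A *\<^sub>v v + B *\<^sub>v w) @\<^sub>v (0\<^sub>m 0 c1 *\<^sub>v v + 0\<^sub>m 0 c2 *\<^sub>v w)"
    unfolding append_cols_def using assms by (subst four_block_mat_mult_vec[of _ r c1 _ c2 _ 0]) auto
  also have "\<dots> = A *\<^sub>v v + B *\<^sub>v w"
    by (rule eq_vecI) auto
  finally show ?thesis .
qed

lemma append_vec_assoc: "(a @\<^sub>v b) @\<^sub>v c = a @\<^sub>v (b @\<^sub>v c)"
  by (rule eq_vecI) auto

lemma carrier_vec_addE:
  assumes "x \<in> carrier_vec (k + l)"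
  obtains v w where "v \<in> carrier_vec k" "w \<in> carrier_vec l" "x = v @\<^sub>v w"
  using vec_first_last_append[OF assms] vec_first_carrier vec_last_carrier by metis

lemma block_2_4_mult_vec:
  fixes A1 :: "'a::comm_ring_1 mat"
  assumes "A1 \<in> carrier_mat r c1" "A2 \<in> carrier_mat r c2" "A3 \<in> carrier_mat r c3" "A4 \<in> carrier_mat r c4"
    and "B1 \<in> carrier_mat s c1" "B2 \<in> carrier_mat s c2" "B3 \<in> carrier_mat s c3" "B4 \<in> carrier_mat s c4"
    and "v1 \<in> carrier_vec c1" "v2 \<in> carrier_vec c2" "v3 \<in> carrier_vec c3" "v4 \<in> carrier_vec c4"
  shows "((A1 @\<^sub>c A2 @\<^sub>c A3 @\<^sub>c A4) @\<^sub>r (B1 @\<^sub>c B2 @\<^sub>c B3 @\<^sub>c B4)) *\<^sub>v (v1 @\<^sub>v v2 @\<^sub>v v3 @\<^sub>v v4)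
    = (A1 *\<^sub>v v1 + (A2 *\<^sub>v v2 + (A3 *\<^sub>v v3 + A4 *\<^sub>v v4)))
      @\<^sub>v (B1 *\<^sub>v v1 + (B2 *\<^sub>v v2 + (B3 *\<^sub>v v3 + B4 *\<^sub>v v4)))"
proof -
  have "(C1 @\<^sub>c C2 @\<^sub>c C3 @\<^sub>c C4) *\<^sub>v (v1 @\<^sub>v v2 @\<^sub>v v3 @\<^sub>v v4)
      = C1 *\<^sub>v v1 + (C2 *\<^sub>v v2 + (C3 *\<^sub>v v3 + C4 *\<^sub>v v4))"
    if "C1 \<in> carrier_mat t c1" "C2 \<in> carrier_mat t c2" "C3 \<in> carrier_mat t c3" "C4 \<in> carrier_mat t c4"
    for C1 C2 C3 C4 :: "'a mat" and t
    using that assms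
    by (simp add: append_cols_mult_vec[of _ t c1 _ "c2 + (c3 + c4)"]
        append_cols_mult_vec[of _ t c2 _ "c3 + c4"] append_cols_mult_vec[of _ t c3 _ c4])
  moreover have "((A1 @\<^sub>c A2 @\<^sub>c A3 @\<^sub>c A4) @\<^sub>r (B1 @\<^sub>c B2 @\<^sub>c B3 @\<^sub>c B4)) *\<^sub>v (v1 @\<^sub>v v2 @\<^sub>v v3 @\<^sub>v v4)
    = ((A1 @\<^sub>c A2 @\<^sub>c A3 @\<^sub>c A4) *\<^sub>v (v1 @\<^sub>v v2 @\<^sub>v v3 @\<^sub>v v4))
      @\<^sub>v ((B1 @\<^sub>c B2 @\<^sub>c B3 @\<^sub>c B4) *\<^sub>v (v1 @\<^sub>v v2 @\<^sub>v v3 @\<^sub>v v4))"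
    using assms by (intro mat_mult_append[of _ r "c1 + (c2 + (c3 + c4))" _ s]) auto
  ultimately show ?thesis using assms by simp
qed

lemma smult_mat_mult_smult_vec:
  fixes X :: "'a::comm_ring_1 mat"
  assumes "X \<in> carrier_mat r s" "v \<in> carrier_vec s"
  shows "(b \<cdot>\<^sub>m X) *\<^sub>v (a \<cdot>\<^sub>v v) = (b * a) \<cdot>\<^sub>v (X *\<^sub>v v)"
  using assms by (intro eq_vecI) (auto simp: scalar_prod_def sum_distrib_left ac_simps)

text \<open>The coordinates carry the weight matrix \<open>D\<close> and the coefficient block
  carries its inverse \<open>W\<close>. They cancel, and the duplication matrix \<open>J\<close>
  meets the bare triangle vector. The scalar weights cancel likewise when b is the reciprocal of a
  up to sign.\<close>

lemma mult_basis_mult_vec: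
  fixes X :: "'a::comm_ring_1 mat"
  assumes "X \<in> carrier_mat r s" "J \<in> carrier_mat s N" "W \<in> carrier_mat N N" "D \<in> carrier_mat N N"
    and "W * D = 1\<^sub>m N" "v \<in> carrier_vec N"
  shows "(b \<cdot>\<^sub>m (X * J * W)) *\<^sub>v (a \<cdot>\<^sub>v (D *\<^sub>v v)) = (b * a) \<cdot>\<^sub>v (X *\<^sub>v (J *\<^sub>v v))"
proof -
  have "W *\<^sub>v (D *\<^sub>v v) = (W * D) *\<^sub>v v"
    using assms by (intro assoc_mult_mat_vec[symmetric]) auto
  then have "W *\<^sub>v (D *\<^sub>v v) = v"
    unfolding assms(5) using assms(6) by simp
  then have "(X * J * W) *\<^sub>v (D *\<^sub>v v) = X *\<^sub>v (J *\<^sub>v v)"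
    using assms(1-4,6) by (simp add: assoc_mult_mat_vec[of _ r N _ N] assoc_mult_mat_vec[of _ r s _ N])
  moreover have "(b \<cdot>\<^sub>m (X * J * W)) *\<^sub>v (a \<cdot>\<^sub>v (D *\<^sub>v v)) = (b * a) \<cdot>\<^sub>v ((X * J * W) *\<^sub>v (D *\<^sub>v v))"
    using assms by (intro smult_mat_mult_smult_vec[of _ r N]) auto
  ultimately show ?thesis by simp
qed

section \<open>The action of the two coefficient blocks\<close>

lemma kron_row_one_carrier [simp]:
  "x \<in> carrier_vec c \<Longrightarrow> mat_of_row x \<Otimes> 1\<^sub>m k \<in> carrier_mat k (k * c)"
  by (auto simp: kron_def mult.commute)

lemma kron_one_row_carrier [simp]:
  "x \<in> carrier_vec r \<Longrightarrow> 1\<^sub>m c \<Otimes> mat_of_row x \<in> carrier_mat c (r * c)"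
  by (auto simp: kron_def mult.commute)

text \<open>This is the number of real parameters of a Hermitian matrix: a symmetric real part and a
  skew-symmetric imaginary part.\<close>

lemma vec_S_dims: "k * (k + 1) div 2 + k * (k - 1) div 2 = (k::nat)\<^sup>2"
proof -
  have "k * (k + 1) + k * (k - 1) = 2 * k\<^sup>2"
    by (cases k) (auto simp: power2_eq_square algebra_simps)
  moreover have "even (k * (k + 1))" "even (k * (k - 1))" by (cases k; simp)+
  ultimately show ?thesis by (simp add: div_plus_div_distrib_dvd_left[symmetric])
qed

lemma Y1_hat_carrier:
  assumes "u \<in> carrier_vec n" "p \<in> carrier_vec m"
  shows "Y1_hat a1 a2 u p \<in> carrier_mat (2 * n) (n\<^sup>2 + (m * n + m * n))"
proof -
  define N1 N2 where "N1 = n * (n + 1) div 2" and "N2 = n * (n - 1) div 2"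
  note [simp] = J_S_carrier[of n, folded N1_def, unfolded power2_eq_square] J_SK_carrier[of n, folded N2_def, unfolded power2_eq_square]
    inv_D_S_carrier[of n, folded N1_def] inv_D_SK_carrier[of n, folded N2_def]
  have "Y1_hat a1 a2 u p \<in> carrier_mat (n + n) (N1 + (N2 + (m * n + m * n)))"
    using assms unfolding Y1_hat_def Let_def
    by (intro carrier_append_rows append_cols_carrier smult_carrier_mat mult_carrier_mat[of _ n N1 _ N1]
      mult_carrier_mat[of _ n N2 _ N2] mult_carrier_mat[of _ n "n * n"]) auto
  moreover have "N1 + (N2 + (m * n + m * n)) = n\<^sup>2 + (m * n + m * n)"
    using vec_S_dims[of n] by (simp only: N1_def N2_def add.assoc[symmetric])
  ultimately show ?thesis by (simp only: mult_2)
qed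

text \<open>The right-hand side stacks the real and the imaginary part of A u + B' p, where A = S +
  iK and B' is the conjugate transpose of V + iW. Conjugation turns iW into -iW, which explains the
  signs in the last two block columns.\<close>

lemma Y1_hat_mult_vec:
  assumes up: "u \<in> carrier_vec n" "p \<in> carrier_vec m" and nz: "a1 \<noteq> 0" "a2 \<noteq> 0"
    and S: "S \<in> carrier_mat n n" "transpose_mat S = S"
    and K: "K \<in> carrier_mat n n" "transpose_mat K = - K"
    and V: "V \<in> carrier_mat m n" and W: "W \<in> carrier_mat m n"
  shows "Y1_hat a1 a2 u p *\<^sub>v
      (a1 \<cdot>\<^sub>v (D_S n *\<^sub>v vec_S S) @\<^sub>v a1 \<cdot>\<^sub>v (D_SK n *\<^sub>v vec_SK K) @\<^sub>v a2 \<cdot>\<^sub>v vec_cols V @\<^sub>v a2 \<cdot>\<^sub>v vec_cols W)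
    = (S *\<^sub>v Re_vec u + (- (K *\<^sub>v Im_vec u) + (transpose_mat V *\<^sub>v Re_vec p + transpose_mat W *\<^sub>v Im_vec p)))
      @\<^sub>v (S *\<^sub>v Im_vec u + (K *\<^sub>v Re_vec u + (transpose_mat V *\<^sub>v Im_vec p + - (transpose_mat W *\<^sub>v Re_vec p))))"
proof -
  define N1 N2 where "N1 = n * (n + 1) div 2" and "N2 = n * (n - 1) div 2"
  note [simp] = J_S_carrier[of n, folded N1_def, unfolded power2_eq_square] J_SK_carrier[of n, folded N2_def, unfolded power2_eq_square]
    inv_D_S_carrier[of n, folded N1_def] inv_D_SK_carrier[of n, folded N2_def]
    D_S_carrier[of n, folded N1_def] D_SK_carrier[of n, folded N2_def]
    inv_D_S_mult[of n, folded N1_def] inv_D_SK_mult[of n, folded N2_def]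
    vec_S_carrier[OF S(1), folded N1_def] vec_SK_carrier[OF K(1), folded N2_def]
  have [simp]: "(-1) \<cdot>\<^sub>v x = - x" for x :: "real vec" by (rule eq_vecI) auto
  have S1: "(b \<cdot>\<^sub>m ((mat_of_row x \<Otimes> 1\<^sub>m n) * J_S n * inv_mat (D_S n))) *\<^sub>v (a1 \<cdot>\<^sub>v (D_S n *\<^sub>v vec_S S))
      = (b * a1) \<cdot>\<^sub>v (S *\<^sub>v x)" if "x \<in> carrier_vec n" for x b
    using that S by (subst mult_basis_mult_vec[of _ n "n * n" _ N1])
      (auto simp: J_S_mult_vec_S kron_row_one_mult_vec_cols[OF S(1)])
  have K1: "(b \<cdot>\<^sub>m ((mat_of_row x \<Otimes> 1\<^sub>m n) * J_SK n * inv_mat (D_SK n))) *\<^sub>v (a1 \<cdot>\<^sub>v (D_SK n *\<^sub>v vec_SK K))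
      = (b * a1) \<cdot>\<^sub>v (K *\<^sub>v x)" if "x \<in> carrier_vec n" for x b
    using that K by (subst mult_basis_mult_vec[of _ n "n * n" _ N2])
      (auto simp: J_SK_mult_vec_SK kron_row_one_mult_vec_cols[OF K(1)])
  have V1: "(b \<cdot>\<^sub>m (1\<^sub>m n \<Otimes> mat_of_row x)) *\<^sub>v (a2 \<cdot>\<^sub>v vec_cols V) = (b * a2) \<cdot>\<^sub>v (transpose_mat V *\<^sub>v x)"
    if "x \<in> carrier_vec m" "V \<in> carrier_mat m n" for x b V
    using that by (subst smult_mat_mult_smult_vec[of _ n "m * n"])
      (auto simp: kron_one_row_mult_vec_cols[OF that(2)])
  have C1: "b \<cdot>\<^sub>m ((mat_of_row x \<Otimes> 1\<^sub>m n) * J_S n * inv_mat (D_S n)) \<in> carrier_mat n N1"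
    if "x \<in> carrier_vec n" for x b
    using that by (intro smult_carrier_mat mult_carrier_mat[of _ n N1 _ N1] mult_carrier_mat[of _ n "n * n"]) auto
  have C2: "b \<cdot>\<^sub>m ((mat_of_row x \<Otimes> 1\<^sub>m n) * J_SK n * inv_mat (D_SK n)) \<in> carrier_mat n N2"
    if "x \<in> carrier_vec n" for x b
    using that by (intro smult_carrier_mat mult_carrier_mat[of _ n N2 _ N2] mult_carrier_mat[of _ n "n * n"]) auto
  have C3: "b \<cdot>\<^sub>m (1\<^sub>m n \<Otimes> mat_of_row x) \<in> carrier_mat n (m * n)" if "x \<in> carrier_vec m" for x and b :: real
    using that by simp
  have W1: "a1 \<cdot>\<^sub>v (D_S n *\<^sub>v vec_S S) \<in> carrier_vec N1" "a1 \<cdot>\<^sub>v (D_SK n *\<^sub>v vec_SK K) \<in> carrier_vec N2"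
    "a2 \<cdot>\<^sub>v vec_cols V \<in> carrier_vec (m * n)" "a2 \<cdot>\<^sub>v vec_cols W \<in> carrier_vec (m * n)"
    using V W by (auto intro!: mult_mat_vec_carrier[of _ N1 N1] mult_mat_vec_carrier[of _ N2 N2])
  have up': "Re_vec u \<in> carrier_vec n" "Im_vec u \<in> carrier_vec n" "Re_vec p \<in> carrier_vec m" "Im_vec p \<in> carrier_vec m"
    using up by auto
  show ?thesis
    unfolding Y1_hat_def Let_def carrier_vecD[OF up(1)]
    using nz
    by (subst block_2_4_mult_vec[OF C1 C2 C3 C3 C1 C2 C3 C3 W1])
      (simp_all only: up' S1[OF up'(1)] S1[OF up'(2)] K1[OF up'(1)] K1[OF up'(2)]
        V1[OF up'(3) V] V1[OF up'(4) V] V1[OF up'(3) W] V1[OF up'(4) W], simp)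
qed

lemma Y2_hat_carrier:
  assumes "u \<in> carrier_vec n" "p \<in> carrier_vec m"
  shows "Y2_hat a2 a3 u p \<in> carrier_mat (2 * m) ((m * n + m * n) + 2 * m\<^sup>2)"
proof -
  have "Y2_hat a2 a3 u p \<in> carrier_mat (m + m) (m * n + (m * n + (m * m + m * m)))"
    using assms unfolding Y2_hat_def Let_def
    by (intro carrier_append_rows append_cols_carrier smult_carrier_mat) auto
  then show ?thesis by (simp add: power2_eq_square mult_2 add.assoc)
qed

text \<open>Here the stacked parts are those of (V + iW) u + (X + iZ) p. No adjoint occurs, so the
  signs are those of ordinary complex multiplication.\<close>

lemma Y2_hat_mult_vec:
  assumes up: "u \<in> carrier_vec n" "p \<in> carrier_vec m" and nz: "a2 \<noteq> 0" "a3 \<noteq> 0"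
    and V: "V \<in> carrier_mat m n" and W: "W \<in> carrier_mat m n"
    and X: "X \<in> carrier_mat m m" and Z: "Z \<in> carrier_mat m m"
  shows "Y2_hat a2 a3 u p *\<^sub>v
      (a2 \<cdot>\<^sub>v vec_cols V @\<^sub>v a2 \<cdot>\<^sub>v vec_cols W @\<^sub>v a3 \<cdot>\<^sub>v vec_cols X @\<^sub>v a3 \<cdot>\<^sub>v vec_cols Z)
    = (V *\<^sub>v Re_vec u + (- (W *\<^sub>v Im_vec u) + (X *\<^sub>v Re_vec p + - (Z *\<^sub>v Im_vec p))))
      @\<^sub>v (V *\<^sub>v Im_vec u + (W *\<^sub>v Re_vec u + (X *\<^sub>v Im_vec p + Z *\<^sub>v Re_vec p)))"
proof -
  have [simp]: "(-1) \<cdot>\<^sub>v x = - x" for x :: "real vec" by (rule eq_vecI) auto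
  have V1: "(b \<cdot>\<^sub>m (mat_of_row x \<Otimes> 1\<^sub>m m)) *\<^sub>v (a \<cdot>\<^sub>v vec_cols V) = (b * a) \<cdot>\<^sub>v (V *\<^sub>v x)"
    if "x \<in> carrier_vec k" "V \<in> carrier_mat m k" for x :: "real vec" and a b V k
    using that by (subst smult_mat_mult_smult_vec[of _ m "m * k"])
      (auto simp: kron_row_one_mult_vec_cols[OF that(2)])
  show ?thesis
    unfolding Y2_hat_def Let_def carrier_vecD[OF up(2)]
    by (subst block_2_4_mult_vec[of _ m "m * n" _ "m * n" _ "m * m" _ "m * m" _ m];
      use up V W X Z nz in \<open>(intro smult_carrier_mat smult_carrier_vec[THEN iffD2])?;
        simp add: V1[of _ n] V1[of _ m]\<close>)
qed

section \<open>Complex matrices through their real and imaginary parts\<close>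

lemma mat_adjoint_index [simp]:
  "i < dim_col A \<Longrightarrow> j < dim_row A \<Longrightarrow> mat_adjoint A $$ (i, j) = conjugate (A $$ (j, i))"
  by (simp add: mat_adjoint_def mat_of_rows_index)

lemma mat_adjoint_dim [simp]: "dim_row (mat_adjoint A) = dim_col A" "dim_col (mat_adjoint A) = dim_row A"
  by (simp_all add: mat_adjoint_def)

lemma mat_adjoint_carrier [simp]: "A \<in> carrier_mat r c \<Longrightarrow> mat_adjoint A \<in> carrier_mat c r"
  by (intro carrier_matI) auto

lemma mat_adjoint_add:
  "A \<in> carrier_mat r c \<Longrightarrow> B \<in> carrier_mat r c \<Longrightarrow> mat_adjoint (A + B) = mat_adjoint A + mat_adjoint B"
  by (intro eq_matI) (auto simp: conjugate_dist_add)

lemma Re_vec_mult: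
  assumes "A \<in> carrier_mat r c" "v \<in> carrier_vec c"
  shows "Re_vec (A *\<^sub>v v) = map_mat Re A *\<^sub>v Re_vec v - map_mat Im A *\<^sub>v Im_vec v"
    and "Im_vec (A *\<^sub>v v) = map_mat Re A *\<^sub>v Im_vec v + map_mat Im A *\<^sub>v Re_vec v"
  using assms by (auto intro!: eq_vecI simp: scalar_prod_def sum_subtractf sum.distrib)

lemma map_mat_adjoint:
  "map_mat Re (mat_adjoint A) = transpose_mat (map_mat Re A)"
  "map_mat Im (mat_adjoint A) = - transpose_mat (map_mat Im A)"
  by (auto intro!: eq_matI simp: conjugate_complex_def)

lemma uminus_mat_mult_vec:
  fixes A :: "'a::comm_ring_1 mat"
  shows "A \<in> carrier_mat r c \<Longrightarrow> v \<in> carrier_vec c \<Longrightarrow> (- A) *\<^sub>v v = - (A *\<^sub>v v)"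
  by (intro eq_vecI) (auto simp: scalar_prod_def sum_negf)

lemma Re_Im_vec_eq_iff: "Re_vec v = Re_vec w \<and> Im_vec v = Im_vec w \<longleftrightarrow> v = w"
  by (auto simp: vec_eq_iff complex_eq_iff)

text \<open>Comparing real and imaginary parts in A^* = A gives both identities. They justify
  storing the two parts by \<open>vec_S\<close> and \<open>vec_SK\<close>.\<close>

lemma hermitian_mat_Re_Im:
  assumes "A \<in> carrier_mat n n" "hermitian_mat A"
  shows "transpose_mat (map_mat Re A) = map_mat Re A" "transpose_mat (map_mat Im A) = - map_mat Im A"
proof -
  from assms have "mat_adjoint A = A" by (simp add: hermitian_mat_def)
  then show "transpose_mat (map_mat Re A) = map_mat Re A" "transpose_mat (map_mat Im A) = - map_mat Im A"
    using map_mat_adjoint[of A] by (simp, metis uminus_uminus_mat)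
qed

definition complex_mat :: "real mat \<Rightarrow> real mat \<Rightarrow> complex mat" where
  "complex_mat A B = mat (dim_row A) (dim_col A) (\<lambda>e. Complex (A $$ e) (B $$ e))"

definition complex_vec :: "real vec \<Rightarrow> real vec \<Rightarrow> complex vec" where
  "complex_vec v w = vec (dim_vec v) (\<lambda>i. Complex (v $ i) (w $ i))"

lemma complex_mat [simp]:
  assumes "A \<in> carrier_mat r c" "B \<in> carrier_mat r c"
  shows "complex_mat A B \<in> carrier_mat r c" "map_mat Re (complex_mat A B) = A" "map_mat Im (complex_mat A B) = B"
  using assms by (auto simp: complex_mat_def intro!: eq_matI)

lemma complex_vec [simp]:
  assumes "v \<in> carrier_vec r" "w \<in> carrier_vec r"
  shows "complex_vec v w \<in> carrier_vec r" "Re_vec (complex_vec v w) = v" "Im_vec (complex_vec v w) = w"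
  using assms by (auto simp: complex_vec_def intro!: eq_vecI)

lemma hermitian_complex_mat:
  assumes "A \<in> carrier_mat n n" "transpose_mat A = A" "B \<in> carrier_mat n n" "transpose_mat B = - B"
  shows "hermitian_mat (complex_mat A B)"
proof -
  have "mat_adjoint (complex_mat A B) = complex_mat A B"
  proof (rule eq_matI)
    fix i j assume "i < dim_row (complex_mat A B)" "j < dim_col (complex_mat A B)"
    then have ij: "i < n" "j < n" using assms by (auto simp: complex_mat_def)
    show "mat_adjoint (complex_mat A B) $$ (i, j) = complex_mat A B $$ (i, j)"
      using assms(1,3) ij symmetric_swap[OF assms(1,2) ij] skew_symmetric_swap[OF assms(3,4) ij]
      by (simp add: complex_mat_def conjugate_complex_def complex_eq_iff)
  qed (use assms in \<open>auto simp: complex_mat_def\<close>)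
  with assms show ?thesis
    by (simp add: hermitian_mat_def complex_mat_def)
qed

lemma fnorm_sq_hermitian:
  assumes "A \<in> carrier_mat n n" "hermitian_mat A"
  shows "(fnorm A)\<^sup>2 = (vnorm2 (D_S n *\<^sub>v vec_S (map_mat Re A)))\<^sup>2 + (vnorm2 (D_SK n *\<^sub>v vec_SK (map_mat Im A)))\<^sup>2"
  using assms hermitian_mat_Re_Im[OF assms] by (simp add: fnorm_sq_complex vnorm2_sq_D_S vnorm2_sq_D_SK)

section \<open>Perturbations as points of a Euclidean space\<close>

text \<open>The order of the ten pieces is that of the columns of the coefficient matrix, and each
  piece carries the weight whose reciprocal, up to sign, stands in its columns.\<close>

definition scaled_vec :: "real \<Rightarrow> real \<Rightarrow> real \<Rightarrow> real \<Rightarrow> real \<Rightarrow> perturbation \<Rightarrow> real vec" where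
  "scaled_vec a1 a2 a3 b1 b2 = (\<lambda>(A, B, C, d, e).
     a1 \<cdot>\<^sub>v (D_S (dim_row A) *\<^sub>v vec_S (map_mat Re A)) @\<^sub>v a1 \<cdot>\<^sub>v (D_SK (dim_row A) *\<^sub>v vec_SK (map_mat Im A))
     @\<^sub>v a2 \<cdot>\<^sub>v vec_cols (map_mat Re B) @\<^sub>v a2 \<cdot>\<^sub>v vec_cols (map_mat Im B)
     @\<^sub>v a3 \<cdot>\<^sub>v vec_cols (map_mat Re C) @\<^sub>v a3 \<cdot>\<^sub>v vec_cols (map_mat Im C)
     @\<^sub>v b1 \<cdot>\<^sub>v Re_vec d @\<^sub>v b1 \<cdot>\<^sub>v Im_vec d @\<^sub>v b2 \<cdot>\<^sub>v Re_vec e @\<^sub>v b2 \<cdot>\<^sub>v Im_vec e)"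

text \<open>The structural conditions are kept apart from the perturbed equation: without the
  equation the coordinates range over a whole Euclidean space.\<close>

definition perturbation_space :: "nat \<Rightarrow> nat \<Rightarrow> perturbation set" where
  "perturbation_space n m = {(A, B, C, d, e). A \<in> carrier_mat n n \<and> hermitian_mat A \<and>
     B \<in> carrier_mat m n \<and> C \<in> carrier_mat m m \<and> d \<in> carrier_vec n \<and> e \<in> carrier_vec m}"

lemma perturbation_size_eq_vnorm2:
  assumes "\<Delta> \<in> perturbation_space n m"
  shows "perturbation_size a1 a2 a3 b1 b2 \<Delta> = vnorm2 (scaled_vec a1 a2 a3 b1 b2 \<Delta>)"
proof -
  obtain A B C d e where \<Delta>: "\<Delta> = (A, B, C, d, e)" "A \<in> carrier_mat n n" "hermitian_mat A"
    using assms by (auto simp: perturbation_space_def)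
  have "(vnorm2 (scaled_vec a1 a2 a3 b1 b2 \<Delta>))\<^sup>2 = a1\<^sup>2 * (fnorm A)\<^sup>2 + a2\<^sup>2 * (fnorm B)\<^sup>2 + a3\<^sup>2 * (fnorm C)\<^sup>2
      + b1\<^sup>2 * (vnorm2 d)\<^sup>2 + b2\<^sup>2 * (vnorm2 e)\<^sup>2"
    unfolding fnorm_sq_hermitian[OF \<Delta>(2,3)] fnorm_sq_complex[of B] fnorm_sq_complex[of C]
      vnorm2_sq_complex[of d] vnorm2_sq_complex[of e]
    using \<Delta>(2) by (simp add: scaled_vec_def \<Delta>(1) vnorm2_sq_append vnorm2_sq_smult vnorm2_sq_vec_cols algebra_simps)
  then show ?thesis
    by (simp add: perturbation_size_def \<Delta>(1) real_sqrt_unique[OF _ vnorm2_nonneg])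
qed

definition scaled_dim :: "nat \<Rightarrow> nat \<Rightarrow> nat" where
  "scaled_dim n m = (n\<^sup>2 + (m * n + m * n) + 2 * m\<^sup>2) + (2 * n + 2 * m)"

lemma D_dims: "dim_row (D_S k) + dim_row (D_SK k) = k * k"
  using vec_S_dims[of k] unfolding carrier_matD(1)[OF D_S_carrier] carrier_matD(1)[OF D_SK_carrier]
  by (simp only: power2_eq_square)

lemma scaled_vec_carrier:
  assumes "\<Delta> \<in> perturbation_space n m"
  shows "scaled_vec a1 a2 a3 b1 b2 \<Delta> \<in> carrier_vec (scaled_dim n m)"
proof -
  obtain A B C d e where \<Delta>: "\<Delta> = (A, B, C, d, e)" "dim_row A = n" "dim_row B = m" "dim_col B = n"
    "dim_row C = m" "dim_col C = m" "dim_vec d = n" "dim_vec e = m"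
    using assms by (auto simp: perturbation_space_def)
  have "dim_vec (scaled_vec a1 a2 a3 b1 b2 \<Delta>)
      = (dim_row (D_S n) + dim_row (D_SK n)) + (m * n + m * n) + 2 * (m * m) + (2 * n + 2 * m)"
    by (simp add: scaled_vec_def \<Delta>)
  then show ?thesis
    by (intro carrier_vecI) (simp only: D_dims scaled_dim_def power2_eq_square)
qed

text \<open>Every piece can be divided by its nonzero weight, freed from the diagonal matrix where
  there is one, and put back into a matrix or vector of the required structure. This turns the
  minimum norm solution into an actual perturbation, so the minimum is attained.\<close>

lemma scaled_vec_surj:
  assumes nz: "a1 \<noteq> 0" "a2 \<noteq> 0" "a3 \<noteq> 0" "b1 \<noteq> 0" "b2 \<noteq> 0"
    and x: "x \<in> carrier_vec (scaled_dim n m)"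
  obtains \<Delta> where "\<Delta> \<in> perturbation_space n m" "scaled_vec a1 a2 a3 b1 b2 \<Delta> = x"
proof -
  have inv: "a \<cdot>\<^sub>v ((1 / a) \<cdot>\<^sub>v y) = y" if "a \<noteq> 0" for a :: real and y
    using that by (intro eq_vecI) auto
  have cols: "\<exists>Z \<in> carrier_mat r c. a \<cdot>\<^sub>v vec_cols Z = y" if "y \<in> carrier_vec (r * c)" "a \<noteq> 0" for a :: real and y r c
    using ex_vec_cols[of "(1 / a) \<cdot>\<^sub>v y" r c] inv that by (metis smult_carrier_vec)
  define N1 N2 where "N1 = n * (n + 1) div 2" and "N2 = n * (n - 1) div 2"
  have "scaled_dim n m = N1 + N2 + (m * n + (m * n + (m * m + (m * m + (n + (n + (m + m)))))))"
    unfolding N1_def N2_def vec_S_dims scaled_dim_def by (simp add: power2_eq_square)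
  with x have "x \<in> carrier_vec (N1 + (N2 + (m * n + (m * n + (m * m + (m * m + (n + (n + (m + m)))))))))"
    by (simp only: add.assoc)
  then obtain x1 x2 x3 x4 x5 x6 x7 x8 x9 x10 where
    c: "x1 \<in> carrier_vec N1" "x2 \<in> carrier_vec N2" "x3 \<in> carrier_vec (m * n)" "x4 \<in> carrier_vec (m * n)"
    "x5 \<in> carrier_vec (m * m)" "x6 \<in> carrier_vec (m * m)" "x7 \<in> carrier_vec n" "x8 \<in> carrier_vec n"
    "x9 \<in> carrier_vec m" "x10 \<in> carrier_vec m"
    and xs: "x = x1 @\<^sub>v x2 @\<^sub>v x3 @\<^sub>v x4 @\<^sub>v x5 @\<^sub>v x6 @\<^sub>v x7 @\<^sub>v x8 @\<^sub>v x9 @\<^sub>v x10"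
    by (elim carrier_vec_addE) (rule that, assumption+, simp)
  have W: "D *\<^sub>v (inv_mat D *\<^sub>v y) = y"
    if "D \<in> carrier_mat N N" "inv_mat D \<in> carrier_mat N N" "D * inv_mat D = 1\<^sub>m N" "y \<in> carrier_vec N"
    for D N and y :: "real vec"
    using assoc_mult_mat_vec[OF that(1,2,4)] one_mult_mat_vec[OF that(4)] by (simp only: that(3))
  have "inv_mat (D_S n) *\<^sub>v ((1 / a1) \<cdot>\<^sub>v x1) \<in> carrier_vec (n * (n + 1) div 2)"
    using mult_mat_vec_carrier[OF inv_D_S_carrier] c(1) by (simp only: N1_def smult_carrier_vec)
  then obtain S where S: "S \<in> carrier_mat n n" "transpose_mat S = S" "vec_S S = inv_mat (D_S n) *\<^sub>v ((1 / a1) \<cdot>\<^sub>v x1)"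
    by (rule ex_vec_S)
  have S': "a1 \<cdot>\<^sub>v (D_S n *\<^sub>v vec_S S) = x1"
    unfolding S(3) using W[OF D_S_carrier inv_D_S_carrier D_S_mult_inv, of "(1 / a1) \<cdot>\<^sub>v x1" n] c(1) inv nz
    by (simp only: N1_def smult_carrier_vec)
  have "inv_mat (D_SK n) *\<^sub>v ((1 / a1) \<cdot>\<^sub>v x2) \<in> carrier_vec (n * (n - 1) div 2)"
    using mult_mat_vec_carrier[OF inv_D_SK_carrier] c(2) by (simp only: N2_def smult_carrier_vec)
  then obtain K where K: "K \<in> carrier_mat n n" "transpose_mat K = - K" "vec_SK K = inv_mat (D_SK n) *\<^sub>v ((1 / a1) \<cdot>\<^sub>v x2)"
    by (rule ex_vec_SK)
  have K': "a1 \<cdot>\<^sub>v (D_SK n *\<^sub>v vec_SK K) = x2"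
    unfolding K(3) using W[OF D_SK_carrier inv_D_SK_carrier D_SK_mult_inv, of "(1 / a1) \<cdot>\<^sub>v x2" n] c(2) inv nz
    by (simp only: N2_def smult_carrier_vec)
  from cols[OF c(3) nz(2)] cols[OF c(4) nz(2)] cols[OF c(5) nz(3)] cols[OF c(6) nz(3)] obtain X3 X4 X5 X6 where
    X: "X3 \<in> carrier_mat m n" "X4 \<in> carrier_mat m n" "X5 \<in> carrier_mat m m" "X6 \<in> carrier_mat m m"
    "a2 \<cdot>\<^sub>v vec_cols X3 = x3" "a2 \<cdot>\<^sub>v vec_cols X4 = x4" "a3 \<cdot>\<^sub>v vec_cols X5 = x5" "a3 \<cdot>\<^sub>v vec_cols X6 = x6"
    by blast
  let ?cv = "\<lambda>b v w. complex_vec ((1 / b) \<cdot>\<^sub>v v) ((1 / b) \<cdot>\<^sub>v w)"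
  let ?\<Delta> = "(complex_mat S K, complex_mat X3 X4, complex_mat X5 X6, ?cv b1 x7 x8, ?cv b2 x9 x10)"
  show thesis
  proof (rule that[of ?\<Delta>])
    show "?\<Delta> \<in> perturbation_space n m"
      using c X S(1,2) K(1,2) by (simp add: perturbation_space_def hermitian_complex_mat)
    have "dim_row (complex_mat S K) = n" using S by (simp add: complex_mat_def)
    then show "scaled_vec a1 a2 a3 b1 b2 ?\<Delta> = x"
      using S(1) K(1) X(1-4) c nz
      by (simp add: scaled_vec_def xs complex_mat[of _ n n] complex_mat[of _ m n] complex_mat[of _ m m]
        complex_vec[of _ n] complex_vec[of _ m] inv S' K' X(5-8))
  qed
qed

section \<open>The real linear system\<close>

lemma smult_one_mult_smult_vec:
  fixes a :: "real vec"
  assumes "a \<in> carrier_vec k" "\<beta> \<noteq> 0"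
  shows "((-1 / \<beta>) \<cdot>\<^sub>m 1\<^sub>m k) *\<^sub>v (\<beta> \<cdot>\<^sub>v a) = - a"
proof -
  have "((-1 / \<beta>) \<cdot>\<^sub>m 1\<^sub>m k) *\<^sub>v (\<beta> \<cdot>\<^sub>v a) = (-1 / \<beta> * \<beta>) \<cdot>\<^sub>v (1\<^sub>m k *\<^sub>v a)"
    by (rule smult_mat_mult_smult_vec[OF one_carrier_mat assms(1)])
  also have "\<dots> = (-1) \<cdot>\<^sub>v a" using assms by simp
  also have "\<dots> = - a" by (rule eq_vecI) auto
  finally show ?thesis .
qed

lemma I1_mult_vec:
  assumes "a \<in> carrier_vec (2 * n)" "b \<in> carrier_vec (2 * m)" "\<beta> \<noteq> 0"
  shows "I1 \<beta> n m *\<^sub>v (\<beta> \<cdot>\<^sub>v a @\<^sub>v b) = - a"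
proof -
  have "I1 \<beta> n m *\<^sub>v (\<beta> \<cdot>\<^sub>v a @\<^sub>v b)
      = ((-1 / \<beta>) \<cdot>\<^sub>m 1\<^sub>m (2 * n)) *\<^sub>v (\<beta> \<cdot>\<^sub>v a) + 0\<^sub>m (2 * n) (2 * m) *\<^sub>v b"
    unfolding I1_def using assms by (intro append_cols_mult_vec[of _ "2 * n" "2 * n" _ "2 * m"]) auto
  also have "\<dots> = - a"
    unfolding smult_one_mult_smult_vec[OF assms(1,3)] using assms(1,2) by (intro eq_vecI) auto
  finally show ?thesis .
qed

lemma I2_mult_vec:
  assumes "a \<in> carrier_vec (2 * n)" "b \<in> carrier_vec (2 * m)" "\<beta> \<noteq> 0"
  shows "I2 \<beta> n m *\<^sub>v (a @\<^sub>v \<beta> \<cdot>\<^sub>v b) = - b"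
proof -
  have "I2 \<beta> n m *\<^sub>v (a @\<^sub>v \<beta> \<cdot>\<^sub>v b)
      = 0\<^sub>m (2 * m) (2 * n) *\<^sub>v a + ((-1 / \<beta>) \<cdot>\<^sub>m 1\<^sub>m (2 * m)) *\<^sub>v (\<beta> \<cdot>\<^sub>v b)"
    unfolding I2_def using assms by (intro append_cols_mult_vec[of _ "2 * m" "2 * n" _ "2 * m"]) auto
  also have "\<dots> = - b"
    unfolding smult_one_mult_smult_vec[OF assms(2,3)] using assms(1,2) by (intro eq_vecI) auto
  finally show ?thesis .
qed

lemma smult_append_vec: "a \<cdot>\<^sub>v (v @\<^sub>v w) = a \<cdot>\<^sub>v v @\<^sub>v a \<cdot>\<^sub>v w"
  by (rule eq_vecI) auto

abbreviation coeff_mat :: "real \<Rightarrow> real \<Rightarrow> real \<Rightarrow> real \<Rightarrow> real \<Rightarrow> complex vec \<Rightarrow> complex vec \<Rightarrow> real mat" where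
  "coeff_mat a1 a2 a3 b1 b2 u p \<equiv> four_block_mat (Y1 a1 a2 u p) (I1 b1 (dim_vec u) (dim_vec p))
     (Y2 a2 a3 u p) (I2 b2 (dim_vec u) (dim_vec p))"

lemma coeff_blocks_carrier:
  assumes "u \<in> carrier_vec n" "p \<in> carrier_vec m"
  shows "Y1 a1 a2 u p \<in> carrier_mat (2 * n) (n\<^sup>2 + (m * n + m * n) + 2 * m\<^sup>2)"
    and "Y2 a2 a3 u p \<in> carrier_mat (2 * m) (n\<^sup>2 + (m * n + m * n) + 2 * m\<^sup>2)"
    and "I1 b1 n m \<in> carrier_mat (2 * n) (2 * n + 2 * m)"
    and "I2 b2 n m \<in> carrier_mat (2 * m) (2 * n + 2 * m)"
  using append_cols_carrier[OF Y1_hat_carrier[OF assms, of a1 a2] zero_carrier_mat[of "2 * n" "2 * m\<^sup>2"]]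
    append_cols_carrier[OF zero_carrier_mat[of "2 * m" "n\<^sup>2"] Y2_hat_carrier[OF assms, of a2 a3]] assms
  by (simp_all add: Y1_def Y2_def I1_def I2_def add.assoc)

lemma coeff_mat_carrier:
  assumes "u \<in> carrier_vec n" "p \<in> carrier_vec m"
  shows "coeff_mat a1 a2 a3 b1 b2 u p \<in> carrier_mat (2 * n + 2 * m) (scaled_dim n m)"
  unfolding scaled_dim_def carrier_vecD[OF assms(1)] carrier_vecD[OF assms(2)]
  by (rule four_block_carrier_mat[OF coeff_blocks_carrier(1)[OF assms] coeff_blocks_carrier(4)[OF assms]])

definition real_stack :: "complex vec \<Rightarrow> complex vec \<Rightarrow> real vec" where
  "real_stack v w = Re_vec v @\<^sub>v Im_vec v @\<^sub>v Re_vec w @\<^sub>v Im_vec w"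

lemma real_stack_carrier:
  "v \<in> carrier_vec n \<Longrightarrow> w \<in> carrier_vec m \<Longrightarrow> real_stack v w \<in> carrier_vec (2 * n + 2 * m)"
  by (intro carrier_vecI) (simp add: real_stack_def)

lemma real_stack_eq_iff:
  assumes "v \<in> carrier_vec n" "v' \<in> carrier_vec n" "w \<in> carrier_vec m" "w' \<in> carrier_vec m"
  shows "real_stack v w = real_stack v' w' \<longleftrightarrow> v = v' \<and> w = w'"
proof -
  have "real_stack v w = real_stack v' w' \<longleftrightarrow>
      (Re_vec v = Re_vec v' \<and> Im_vec v = Im_vec v') \<and> (Re_vec w = Re_vec w' \<and> Im_vec w = Im_vec w')"
    using assms by (simp add: real_stack_def append_vec_eq[of _ n] append_vec_eq[of _ m])
  then show ?thesis by (simp only: Re_Im_vec_eq_iff)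
qed

text \<open>Every real right-hand side is the residual pair of two complex vectors, so surjectivity
  of the coefficient matrix can be tested on complex data.\<close>

lemma real_stack_surj:
  assumes "b \<in> carrier_vec (2 * n + 2 * m)"
  obtains v w where "v \<in> carrier_vec n" "w \<in> carrier_vec m" "real_stack v w = b"
proof -
  have "2 * n + 2 * m = n + (n + (m + m))" by simp
  with assms have "b \<in> carrier_vec (n + (n + (m + m)))" by simp
  then obtain b1 b2 b3 b4 where b: "b1 \<in> carrier_vec n" "b2 \<in> carrier_vec n"
    "b3 \<in> carrier_vec m" "b4 \<in> carrier_vec m" "b = b1 @\<^sub>v b2 @\<^sub>v b3 @\<^sub>v b4"
    by (elim carrier_vec_addE) (rule that, assumption+, simp)
  then show thesis
    by (intro that[of "complex_vec b1 b2" "complex_vec b3 b4"])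
      (auto simp: real_stack_def complex_vec[of _ n] complex_vec[of _ m])
qed

lemma Re_Im_vec_add:
  assumes "v \<in> carrier_vec k" "w \<in> carrier_vec k"
  shows "Re_vec (v + w) = Re_vec v + Re_vec w" "Im_vec (v + w) = Im_vec v + Im_vec w"
  using assms by (intro eq_vecI; simp)+

lemma Re_Im_vec_diff:
  assumes "v \<in> carrier_vec k" "w \<in> carrier_vec k"
  shows "(Re_vec v @\<^sub>v Im_vec v) + - (Re_vec w @\<^sub>v Im_vec w) = Re_vec (v - w) @\<^sub>v Im_vec (v - w)"
  using assms by (intro eq_vecI) auto

text \<open>Splitting complex products yields differences of pairs, the block products a
  right-nested sum. The double negation in the first identity stems from the imaginary part of an
  adjoint, which is a negated transpose.\<close>

lemma vec_rearrange:
  fixes a b c d :: "real vec"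
  assumes "a \<in> carrier_vec k" "b \<in> carrier_vec k" "c \<in> carrier_vec k" "d \<in> carrier_vec k"
  shows "(a - b) + (c - - d) = a + (- b + (c + d))"
    and "(a - b) + (c - d) = a + (- b + (c + - d))"
    and "(a + b) + (c + d) = a + (b + (c + d))"
  using assms by (intro eq_vecI; simp)+

lemma Re_Im_first_residual:
  assumes "A \<in> carrier_mat n n" "B \<in> carrier_mat m n" "u \<in> carrier_vec n" "p \<in> carrier_vec m"
  shows "Re_vec (A *\<^sub>v u + mat_adjoint B *\<^sub>v p) = map_mat Re A *\<^sub>v Re_vec u + (- (map_mat Im A *\<^sub>v Im_vec u)
      + (transpose_mat (map_mat Re B) *\<^sub>v Re_vec p + transpose_mat (map_mat Im B) *\<^sub>v Im_vec p))" (is ?Re)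
    and "Im_vec (A *\<^sub>v u + mat_adjoint B *\<^sub>v p) = map_mat Re A *\<^sub>v Im_vec u + (map_mat Im A *\<^sub>v Re_vec u
      + (transpose_mat (map_mat Re B) *\<^sub>v Im_vec p + - (transpose_mat (map_mat Im B) *\<^sub>v Re_vec p)))" (is ?Im)
proof -
  note B' = mat_adjoint_carrier[OF assms(2)]
  have T: "transpose_mat (map_mat Im B) \<in> carrier_mat n m" and P: "Re_vec p \<in> carrier_vec m" "Im_vec p \<in> carrier_vec m"
    using assms by auto
  note split = Re_Im_vec_add[OF mult_mat_vec_carrier[OF assms(1,3)] mult_mat_vec_carrier[OF B' assms(4)]]
    Re_vec_mult[OF assms(1,3)] Re_vec_mult[OF B' assms(4)] map_mat_adjoint
    uminus_mat_mult_vec[OF T P(1)] uminus_mat_mult_vec[OF T P(2)]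
  show ?Re
    unfolding split using assms by (intro vec_rearrange(1)[of _ n] carrier_vecI) auto
  show ?Im
    unfolding split using assms by (intro vec_rearrange(3)[of _ n] carrier_vecI) auto
qed

lemma Re_Im_second_residual:
  assumes "B \<in> carrier_mat m n" "C \<in> carrier_mat m m" "u \<in> carrier_vec n" "p \<in> carrier_vec m"
  shows "Re_vec (B *\<^sub>v u + C *\<^sub>v p) = map_mat Re B *\<^sub>v Re_vec u + (- (map_mat Im B *\<^sub>v Im_vec u)
      + (map_mat Re C *\<^sub>v Re_vec p + - (map_mat Im C *\<^sub>v Im_vec p)))" (is ?Re)
    and "Im_vec (B *\<^sub>v u + C *\<^sub>v p) = map_mat Re B *\<^sub>v Im_vec u + (map_mat Im B *\<^sub>v Re_vec u
      + (map_mat Re C *\<^sub>v Im_vec p + map_mat Im C *\<^sub>v Re_vec p))" (is ?Im)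
proof -
  note split = Re_Im_vec_add[OF mult_mat_vec_carrier[OF assms(1,3)] mult_mat_vec_carrier[OF assms(2,4)]]
    Re_vec_mult[OF assms(1,3)] Re_vec_mult[OF assms(2,4)]
  show ?Re
    unfolding split using assms by (intro vec_rearrange(2)[of _ m] carrier_vecI) auto
  show ?Im
    unfolding split using assms by (intro vec_rearrange(3)[of _ m] carrier_vecI) auto
qed

text \<open>The coordinates of \<open>B\<close> are shared by both block rows: \<open>Y1_hat\<close>
  reads them as the adjoint acting on \<open>p\<close>, \<open>Y2_hat\<close> as \<open>B\<close>
  acting on \<open>u\<close>. The zero blocks of \<open>Y1\<close> and \<open>Y2\<close> hide
  \<open>C\<close> and \<open>A\<close>, respectively, and the scaled identity blocks subtract
  \<open>d\<close> and \<open>e\<close>.\<close>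

lemma coeff_mat_mult_scaled_vec:
  assumes up: "u \<in> carrier_vec n" "p \<in> carrier_vec m"
    and nz: "a1 \<noteq> 0" "a2 \<noteq> 0" "a3 \<noteq> 0" "b1 \<noteq> 0" "b2 \<noteq> 0"
    and A: "A \<in> carrier_mat n n" "hermitian_mat A" and B: "B \<in> carrier_mat m n" and C: "C \<in> carrier_mat m m"
    and de: "d \<in> carrier_vec n" "e \<in> carrier_vec m"
  shows "coeff_mat a1 a2 a3 b1 b2 u p *\<^sub>v scaled_vec a1 a2 a3 b1 b2 (A, B, C, d, e)
    = real_stack (A *\<^sub>v u + mat_adjoint B *\<^sub>v p - d) (B *\<^sub>v u + C *\<^sub>v p - e)"
proof -
  note AH = hermitian_mat_Re_Im[OF A]
  define x1 where "x1 = a1 \<cdot>\<^sub>v (D_S n *\<^sub>v vec_S (map_mat Re A)) @\<^sub>v a1 \<cdot>\<^sub>v (D_SK n *\<^sub>v vec_SK (map_mat Im A))"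
  define x2 where "x2 = a2 \<cdot>\<^sub>v vec_cols (map_mat Re B) @\<^sub>v a2 \<cdot>\<^sub>v vec_cols (map_mat Im B)"
  define x3 where "x3 = a3 \<cdot>\<^sub>v vec_cols (map_mat Re C) @\<^sub>v a3 \<cdot>\<^sub>v vec_cols (map_mat Im C)"
  define x4 where "x4 = b1 \<cdot>\<^sub>v (Re_vec d @\<^sub>v Im_vec d)"
  define x5 where "x5 = b2 \<cdot>\<^sub>v (Re_vec e @\<^sub>v Im_vec e)"
  have "dim_vec x1 = dim_row (D_S n) + dim_row (D_SK n)"
    by (simp add: x1_def)
  then have x1: "x1 \<in> carrier_vec (n\<^sup>2)"
    by (intro carrier_vecI) (simp only: D_dims power2_eq_square)
  have x: "x2 \<in> carrier_vec (m * n + m * n)" "x3 \<in> carrier_vec (2 * m\<^sup>2)"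
    "x4 \<in> carrier_vec (2 * n)" "x5 \<in> carrier_vec (2 * m)"
    using B C de
    by (auto simp: x2_def x3_def x4_def x5_def power2_eq_square intro!: carrier_vecI)
  have xs: "scaled_vec a1 a2 a3 b1 b2 (A, B, C, d, e) = ((x1 @\<^sub>v x2) @\<^sub>v x3) @\<^sub>v (x4 @\<^sub>v x5)"
    using A by (simp add: scaled_vec_def x1_def x2_def x3_def x4_def x5_def append_vec_assoc smult_append_vec)
  have "Y1 a1 a2 u p *\<^sub>v ((x1 @\<^sub>v x2) @\<^sub>v x3) = Y1_hat a1 a2 u p *\<^sub>v (x1 @\<^sub>v x2) + 0\<^sub>m (2 * n) (2 * m\<^sup>2) *\<^sub>v x3"
    unfolding Y1_def carrier_vecD[OF up(1)] carrier_vecD[OF up(2)]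
    by (intro append_cols_mult_vec[OF Y1_hat_carrier[OF up] zero_carrier_mat] append_carrier_vec x1 x)
  also have "\<dots> = Y1_hat a1 a2 u p *\<^sub>v (x1 @\<^sub>v x2)"
    using Y1_hat_carrier[OF up, of a1 a2] x by (intro eq_vecI) auto
  also have "\<dots> = Re_vec (A *\<^sub>v u + mat_adjoint B *\<^sub>v p) @\<^sub>v Im_vec (A *\<^sub>v u + mat_adjoint B *\<^sub>v p)"
    unfolding x1_def x2_def append_vec_assoc Re_Im_first_residual[OF A(1) B up]
    using A B up by (intro Y1_hat_mult_vec nz AH) auto
  finally have Y1x: "Y1 a1 a2 u p *\<^sub>v ((x1 @\<^sub>v x2) @\<^sub>v x3)
    = Re_vec (A *\<^sub>v u + mat_adjoint B *\<^sub>v p) @\<^sub>v Im_vec (A *\<^sub>v u + mat_adjoint B *\<^sub>v p)" .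
  \<comment> \<open>The vector is grouped differently here: \<open>Y1\<close> has its zero block at
    the end, against \<open>x3\<close>, while \<open>Y2\<close> has it in front, against
    \<open>x1\<close>.\<close>
  have "Y2 a2 a3 u p *\<^sub>v (x1 @\<^sub>v (x2 @\<^sub>v x3)) = 0\<^sub>m (2 * m) (n\<^sup>2) *\<^sub>v x1 + Y2_hat a2 a3 u p *\<^sub>v (x2 @\<^sub>v x3)"
    unfolding Y2_def carrier_vecD[OF up(1)] carrier_vecD[OF up(2)]
    by (intro append_cols_mult_vec[OF zero_carrier_mat Y2_hat_carrier[OF up]] append_carrier_vec x1 x)
  also have "\<dots> = Y2_hat a2 a3 u p *\<^sub>v (x2 @\<^sub>v x3)"
    using Y2_hat_carrier[OF up, of a2 a3] x1 by (intro eq_vecI) auto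
  also have "\<dots> = Re_vec (B *\<^sub>v u + C *\<^sub>v p) @\<^sub>v Im_vec (B *\<^sub>v u + C *\<^sub>v p)"
    unfolding x2_def x3_def append_vec_assoc Re_Im_second_residual[OF B C up]
    using B C up by (intro Y2_hat_mult_vec nz) auto
  finally have Y2x: "Y2 a2 a3 u p *\<^sub>v (x1 @\<^sub>v (x2 @\<^sub>v x3))
    = Re_vec (B *\<^sub>v u + C *\<^sub>v p) @\<^sub>v Im_vec (B *\<^sub>v u + C *\<^sub>v p)" .
  have "Re_vec d @\<^sub>v Im_vec d \<in> carrier_vec (2 * n)" "Re_vec e @\<^sub>v Im_vec e \<in> carrier_vec (2 * m)"
    using de by (auto intro!: carrier_vecI)
  then have I: "I1 b1 n m *\<^sub>v (x4 @\<^sub>v x5) = - (Re_vec d @\<^sub>v Im_vec d)"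
    "I2 b2 n m *\<^sub>v (x4 @\<^sub>v x5) = - (Re_vec e @\<^sub>v Im_vec e)"
    using x nz by (simp_all add: x4_def x5_def I1_mult_vec I2_mult_vec)
  have "coeff_mat a1 a2 a3 b1 b2 u p *\<^sub>v scaled_vec a1 a2 a3 b1 b2 (A, B, C, d, e)
    = (Y1 a1 a2 u p *\<^sub>v ((x1 @\<^sub>v x2) @\<^sub>v x3) + I1 b1 n m *\<^sub>v (x4 @\<^sub>v x5))
      @\<^sub>v (Y2 a2 a3 u p *\<^sub>v ((x1 @\<^sub>v x2) @\<^sub>v x3) + I2 b2 n m *\<^sub>v (x4 @\<^sub>v x5))"
    unfolding xs carrier_vecD[OF up(1)] carrier_vecD[OF up(2)]
    by (intro four_block_mat_mult_vec[OF coeff_blocks_carrier(1)[OF up] coeff_blocks_carrier(3)[OF up]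
        coeff_blocks_carrier(2)[OF up] coeff_blocks_carrier(4)[OF up]] append_carrier_vec x1 x)
  also have "\<dots> = real_stack (A *\<^sub>v u + mat_adjoint B *\<^sub>v p - d) (B *\<^sub>v u + C *\<^sub>v p - e)"
  proof -
    have "A *\<^sub>v u + mat_adjoint B *\<^sub>v p \<in> carrier_vec n" "B *\<^sub>v u + C *\<^sub>v p \<in> carrier_vec m"
      using B C by (auto intro!: carrier_vecI)
    then show ?thesis
      unfolding Y1x I
      unfolding append_vec_assoc[of x1 x2 x3] Y2x real_stack_def
      by (simp only: Re_Im_vec_diff[OF _ de(1)] Re_Im_vec_diff[OF _ de(2)] append_vec_assoc)
  qed
  finally show ?thesis .
qed

section \<open>The constraint as a residual equation, and the minimum\<close>

text \<open>The perturbed system is linear in the perturbation once \<open>u\<close> and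
  \<open>p\<close> are fixed. Moving the unperturbed terms to the other side leaves exactly the
  residuals there.\<close>

lemma perturbations_G1_iff:
  assumes "E \<in> carrier_mat n n" "F \<in> carrier_mat m n" "G \<in> carrier_mat m m"
    and "q \<in> carrier_vec n" "r \<in> carrier_vec m" and up: "u \<in> carrier_vec n" "p \<in> carrier_vec m"
  shows "(A, B, C, d, e) \<in> perturbations_G1 E F G q r u p \<longleftrightarrow>
    (A, B, C, d, e) \<in> perturbation_space n m \<and>
    A *\<^sub>v u + mat_adjoint B *\<^sub>v p - d = q - E *\<^sub>v u - mat_adjoint F *\<^sub>v p \<and>
    B *\<^sub>v u + C *\<^sub>v p - e = r - F *\<^sub>v u - G *\<^sub>v p"
proof -
  have move: "(v1 + v2) + (v3 + v4) = w1 + w2 \<longleftrightarrow> v2 + v4 - w2 = w1 - v1 - v3"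
    if "v1 \<in> carrier_vec k" "v2 \<in> carrier_vec k" "v3 \<in> carrier_vec k" "v4 \<in> carrier_vec k"
      "w1 \<in> carrier_vec k" "w2 \<in> carrier_vec k" for v1 v2 v3 v4 w1 w2 :: "complex vec" and k
    using that by (auto simp: vec_eq_iff algebra_simps)
  have "saddle_mat (E + A) (F + B) (G + C) *\<^sub>v (u @\<^sub>v p) = (q + d) @\<^sub>v (r + e) \<longleftrightarrow>
    A *\<^sub>v u + mat_adjoint B *\<^sub>v p - d = q - E *\<^sub>v u - mat_adjoint F *\<^sub>v p \<and>
    B *\<^sub>v u + C *\<^sub>v p - e = r - F *\<^sub>v u - G *\<^sub>v p"
    if "A \<in> carrier_mat n n" "B \<in> carrier_mat m n" "C \<in> carrier_mat m m" "d \<in> carrier_vec n" "e \<in> carrier_vec m"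
  proof -
    have "saddle_mat (E + A) (F + B) (G + C) *\<^sub>v (u @\<^sub>v p)
      = ((E *\<^sub>v u + A *\<^sub>v u) + (mat_adjoint F *\<^sub>v p + mat_adjoint B *\<^sub>v p))
        @\<^sub>v ((F *\<^sub>v u + B *\<^sub>v u) + (G *\<^sub>v p + C *\<^sub>v p))"
      unfolding saddle_mat_def using assms that
      by (subst four_block_mat_mult_vec[of _ n n _ m _ m])
        (auto simp: mat_adjoint_add[of _ m n] add_mult_distrib_mat_vec[of _ n n] add_mult_distrib_mat_vec[of _ n m]
          add_mult_distrib_mat_vec[of _ m n] add_mult_distrib_mat_vec[of _ m m])
    moreover have "\<dots> = (q + d) @\<^sub>v (r + e) \<longleftrightarrow>
        (E *\<^sub>v u + A *\<^sub>v u) + (mat_adjoint F *\<^sub>v p + mat_adjoint B *\<^sub>v p) = q + d \<and>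
        (F *\<^sub>v u + B *\<^sub>v u) + (G *\<^sub>v p + C *\<^sub>v p) = r + e"
      using assms that by (intro append_vec_eq[of _ n]) (auto intro!: add_carrier_vec mult_mat_vec_carrier)
    moreover have "(E *\<^sub>v u + A *\<^sub>v u) + (mat_adjoint F *\<^sub>v p + mat_adjoint B *\<^sub>v p) = q + d \<longleftrightarrow>
        A *\<^sub>v u + mat_adjoint B *\<^sub>v p - d = q - E *\<^sub>v u - mat_adjoint F *\<^sub>v p"
      using assms that by (intro move[of _ n]) (auto intro!: mult_mat_vec_carrier)
    moreover have "(F *\<^sub>v u + B *\<^sub>v u) + (G *\<^sub>v p + C *\<^sub>v p) = r + e \<longleftrightarrow>
        B *\<^sub>v u + C *\<^sub>v p - e = r - F *\<^sub>v u - G *\<^sub>v p"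
      using assms that by (intro move[of _ m]) (auto intro!: mult_mat_vec_carrier)
    ultimately show ?thesis by simp
  qed
  then show ?thesis
    unfolding perturbations_G1_def perturbation_space_def carrier_vecD[OF up(1)] carrier_vecD[OF up(2)] by auto
qed

text \<open>The first two conjuncts give the third its meaning: \<open>LEAST\<close> is informative
  only when a minimum exists, and \<open>inv_mat\<close> only for an invertible argument.\<close>

theorem corollary3p1:
  fixes n m :: nat
    and E F G :: "complex mat"
    and q r u p :: "complex vec"
    and \<alpha>\<^sub>1 \<alpha>\<^sub>2 \<alpha>\<^sub>3 \<beta>\<^sub>1 \<beta>\<^sub>2 :: real
  assumes "E \<in> carrier_mat n n" and "hermitian_mat E"
    and "F \<in> carrier_mat m n"
    and "G \<in> carrier_mat m m"
    and "q \<in> carrier_vec n" and "r \<in> carrier_vec m"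
    and "invertible_mat (saddle_mat E F G)"
    and "\<alpha>\<^sub>1 > 0" and "\<alpha>\<^sub>2 > 0" and "\<alpha>\<^sub>3 > 0" and "\<beta>\<^sub>1 > 0" and "\<beta>\<^sub>2 > 0"
    and "u \<in> carrier_vec n" and "p \<in> carrier_vec m"
  shows
    "let Q = q - E *\<^sub>v u - mat_adjoint F *\<^sub>v p;
         R = r - F *\<^sub>v u - G *\<^sub>v p;
         M = four_block_mat (Y1 \<alpha>\<^sub>1 \<alpha>\<^sub>2 u p) (I1 \<beta>\<^sub>1 n m) (Y2 \<alpha>\<^sub>2 \<alpha>\<^sub>3 u p) (I2 \<beta>\<^sub>2 n m)
     in (\<exists>\<Delta>. is_arg_min (perturbation_size \<alpha>\<^sub>1 \<alpha>\<^sub>2 \<alpha>\<^sub>3 \<beta>\<^sub>1 \<beta>\<^sub>2)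
                (\<lambda>\<Delta>. \<Delta> \<in> perturbations_G1 E F G q r u p) \<Delta>) \<and>
        invertible_mat (M * transpose_mat M) \<and>
        backward_error_G1 \<alpha>\<^sub>1 \<alpha>\<^sub>2 \<alpha>\<^sub>3 \<beta>\<^sub>1 \<beta>\<^sub>2 E F G q r u p =
          vnorm2 ((transpose_mat M * inv_mat (M * transpose_mat M)) *\<^sub>v
            (Re_vec Q @\<^sub>v Im_vec Q @\<^sub>v Re_vec R @\<^sub>v Im_vec R))"
proof -
  note up = \<open>u \<in> carrier_vec n\<close> \<open>p \<in> carrier_vec m\<close>
  have nz: "\<alpha>\<^sub>1 \<noteq> 0" "\<alpha>\<^sub>2 \<noteq> 0" "\<alpha>\<^sub>3 \<noteq> 0" "\<beta>\<^sub>1 \<noteq> 0" "\<beta>\<^sub>2 \<noteq> 0"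
    using assms by auto
  define Q where "Q = q - E *\<^sub>v u - mat_adjoint F *\<^sub>v p"
  define R where "R = r - F *\<^sub>v u - G *\<^sub>v p"
  define M where "M = four_block_mat (Y1 \<alpha>\<^sub>1 \<alpha>\<^sub>2 u p) (I1 \<beta>\<^sub>1 n m) (Y2 \<alpha>\<^sub>2 \<alpha>\<^sub>3 u p) (I2 \<beta>\<^sub>2 n m)"
  define P where "P = perturbations_G1 E F G q r u p"
  let ?size = "perturbation_size \<alpha>\<^sub>1 \<alpha>\<^sub>2 \<alpha>\<^sub>3 \<beta>\<^sub>1 \<beta>\<^sub>2" and ?vec = "scaled_vec \<alpha>\<^sub>1 \<alpha>\<^sub>2 \<alpha>\<^sub>3 \<beta>\<^sub>1 \<beta>\<^sub>2"
  let ?N = "2 * n + 2 * m" and ?K = "scaled_dim n m"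
  have QR: "Q \<in> carrier_vec n" "R \<in> carrier_vec m"
    using assms by (auto simp: Q_def R_def intro!: minus_carrier_vec mult_mat_vec_carrier)
  have M_eq: "M = coeff_mat \<alpha>\<^sub>1 \<alpha>\<^sub>2 \<alpha>\<^sub>3 \<beta>\<^sub>1 \<beta>\<^sub>2 u p"
    using up by (simp add: M_def)
  have M: "M \<in> carrier_mat ?N ?K"
    unfolding M_eq by (rule coeff_mat_carrier[OF up])
  have mult: "M *\<^sub>v ?vec (A, B, C, d, e) = real_stack (A *\<^sub>v u + mat_adjoint B *\<^sub>v p - d) (B *\<^sub>v u + C *\<^sub>v p - e)"
    if "(A, B, C, d, e) \<in> perturbation_space n m" for A B C d e
    using that unfolding M_eq perturbation_space_def by (intro coeff_mat_mult_scaled_vec[OF up nz]) auto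
  have P_iff: "\<Delta> \<in> P \<longleftrightarrow> \<Delta> \<in> perturbation_space n m \<and> M *\<^sub>v ?vec \<Delta> = real_stack Q R" for \<Delta>
  proof (cases "\<Delta> \<in> perturbation_space n m")
    case True
    then obtain A B C d e where \<Delta>: "\<Delta> = (A, B, C, d, e)"
      and c: "A \<in> carrier_mat n n" "B \<in> carrier_mat m n" "C \<in> carrier_mat m m" "d \<in> carrier_vec n" "e \<in> carrier_vec m"
      by (auto simp: perturbation_space_def)
    have "A *\<^sub>v u + mat_adjoint B *\<^sub>v p - d \<in> carrier_vec n" "B *\<^sub>v u + C *\<^sub>v p - e \<in> carrier_vec m"
      using c up by (auto intro!: minus_carrier_vec add_carrier_vec mult_mat_vec_carrier)
    then show ?thesis
      using True QR assms unfolding \<Delta> P_def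
      by (subst perturbations_G1_iff[of _ n _ m])
        (simp_all add: mult real_stack_eq_iff[of _ n _ _ m] Q_def[symmetric] R_def[symmetric])
  next
    case False
    then show ?thesis
      using assms unfolding P_def by (cases \<Delta>) (simp add: perturbations_G1_iff[of _ n _ m])
  qed
  have surj: "\<exists>x \<in> carrier_vec ?K. M *\<^sub>v x = b" if "b \<in> carrier_vec ?N" for b
  proof -
    obtain v w where vw: "v \<in> carrier_vec n" "w \<in> carrier_vec m" "real_stack v w = b"
      using real_stack_surj[OF \<open>b \<in> carrier_vec ?N\<close>] .
    \<comment> \<open>With all matrix perturbations zero only the two scaled identity blocks act,
      and they negate: -(-v) = v and -(-w) = w.\<close>
    let ?\<Delta> = "(0\<^sub>m n n, 0\<^sub>m m n, 0\<^sub>m m m, - v, - w)"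
    have \<Delta>: "?\<Delta> \<in> perturbation_space n m"
      using vw by (auto simp: perturbation_space_def hermitian_mat_def intro!: eq_matI)
    have "mat_adjoint (0\<^sub>m m n) = (0\<^sub>m n m :: complex mat)" by (rule eq_matI) auto
    then have "0\<^sub>m n n *\<^sub>v u + mat_adjoint (0\<^sub>m m n) *\<^sub>v p - - v = v" "0\<^sub>m m n *\<^sub>v u + 0\<^sub>m m m *\<^sub>v p - - w = w"
      using vw up by (auto intro!: eq_vecI)
    with mult[OF \<Delta>] vw(3) have "M *\<^sub>v ?vec ?\<Delta> = b" by simp
    with scaled_vec_carrier[OF \<Delta>] show ?thesis by blast
  qed
  obtain W where W: "W \<in> carrier_mat ?N ?N" "M * transpose_mat M * W = 1\<^sub>m ?N"
    using gram_mat_inverse[OF M surj] .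
  have A: "M * transpose_mat M \<in> carrier_mat ?N ?N" using M by auto
  \<comment> \<open>\<open>W\<close> is merely some right inverse of the Gram matrix. From here on
    \<open>inv_mat\<close> itself serves as the inverse, as the formula demands.\<close>
  note inv = inv_mat[OF A W]
  have invertible: "invertible_mat (M * transpose_mat M)"
    using A inv unfolding invertible_mat_def inverts_mat_def by (metis carrier_matD square_mat.simps)
  define x0 where "x0 = (transpose_mat M * inv_mat (M * transpose_mat M)) *\<^sub>v real_stack Q R"
  note x0 = least_norm_solution[OF M inv(1,3) real_stack_carrier[OF QR], folded x0_def]
  obtain \<Delta> where \<Delta>: "\<Delta> \<in> perturbation_space n m" "?vec \<Delta> = x0"
    using scaled_vec_surj[OF nz x0(1)] .
  have "\<Delta> \<in> P" using \<Delta> x0(2) by (simp add: P_iff)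
  have size: "?size \<Delta> = vnorm2 x0"
    using perturbation_size_eq_vnorm2[OF \<Delta>(1)] \<Delta>(2) by simp
  \<comment> \<open>A competing feasible perturbation has coordinates solving the same system, so
    the norm comparison of solutions is a comparison of sizes.\<close>
  have min: "?size \<Delta> \<le> ?size \<Delta>'" if "\<Delta>' \<in> P" for \<Delta>'
  proof -
    from that have "\<Delta>' \<in> perturbation_space n m" "M *\<^sub>v ?vec \<Delta>' = real_stack Q R"
      by (simp_all add: P_iff)
    then show ?thesis
      using x0(3)[OF scaled_vec_carrier] perturbation_size_eq_vnorm2 by (simp add: size)
  qed
  have "is_arg_min ?size (\<lambda>\<Delta>. \<Delta> \<in> P) \<Delta>"
    using \<open>\<Delta> \<in> P\<close> min by (force simp: is_arg_min_def not_less)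
  moreover have "backward_error_G1 \<alpha>\<^sub>1 \<alpha>\<^sub>2 \<alpha>\<^sub>3 \<beta>\<^sub>1 \<beta>\<^sub>2 E F G q r u p = vnorm2 x0"
    unfolding backward_error_G1_def P_def[symmetric] size[symmetric]
    by (rule Least_equality) (use \<open>\<Delta> \<in> P\<close> min in auto)
  ultimately show ?thesis
    using invertible unfolding Let_def Q_def[symmetric] R_def[symmetric] M_def[symmetric] P_def[symmetric]
      real_stack_def[symmetric] x0_def[symmetric] by blast
qed

end
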